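(* Let $\mathcal D$ be a dyadic grid in $\mathbf R^d$, $w\in A_{\mathrm{FW}}$, $\mathcal S\subseteq\mathcal D$ a finite $\eta$-sparse collection, $a=\{a_Q\}_{Q\in\mathcal S}\subseteq(0,\infty)$, and $q,r\in(0,\infty]$ with $q<r$. Then there exists $\delta>0$, depending only on $d$, $q$ and $r$, such that \[ w\big(\{A^q_{\mathcal S}(a)>2\lambda,\ A^r_{\mathcal S}(a)\le\gamma^{\frac1q-\frac1r}\lambda\}\big)\lesssim e^{-\frac{\delta\eta}{\gamma[w]_{\mathrm{FW}}}}\,w\big(\{A^q_{\mathcal S}(a)>\lambda\}\big) \] for all $\lambda,\gamma>0$, with implicit constant depending only on $d$, $q$, $r$.
   Context: A dyadic grid is $\mathcal D^\alpha=\{2^{-j}([0,1)^d+\alpha+k):j\in\mathbf Z,k\in\mathbf Z^d\}$, $\alpha\in\{0,\frac13,\frac23\}^d$. $\mathcal S$ is $\eta$-sparse ($\eta\in(0,1)$) if each $Q\in\mathcal S$ has $E_Q\subseteq Q$ with $|E_Q|\ge\eta|Q|$ and $\{E_Q\}$ pairwise disjoint. For $r\in(0,\infty]$, $A^r_{\mathcal S}(a):=\|\{a_Q\mathbf 1_Q\}_{Q\in\mathcal S}\|_{\ell^r(\mathcal S)}$ pointwise, i.e. $(\sum_{Q\in\mathcal S}a_Q^r\mathbf 1_Q)^{1/r}$ for $r<\infty$ and $\sup_{Q\in\mathcal S}a_Q\mathbf 1_Q$ for $r=\infty$. For a weight $w$, $w(E)=\int_Ew$; $[w]_{\mathrm{FW}}:=\sup_Q\frac1{w(Q)}\int_QM(w\mathbf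 1_Q)\,dx$ (sup over cubes, $M$ the Hardy–Littlewood maximal operator), and $w\in A_{\mathrm{FW}}$ means this is finite. *)

theory Defs
  imports "HOL-Analysis.Analysis"
begin

definition dyadic_cube :: "('n::finite \<Rightarrow> real) \<Rightarrow> int \<Rightarrow> ('n \<Rightarrow> int) \<Rightarrow> (real^'n) set" where
  "dyadic_cube \<alpha> j k = {x. \<forall>i. 2 powr (- real_of_int j) * (\<alpha> i + real_of_int (k i)) \<le> x$i
                              \<and> x$i < 2 powr (- real_of_int j) * (\<alpha> i + real_of_int (k i) + 1)}"

definition dyadic_grid :: "('n::finite \<Rightarrow> real) \<Rightarrow> (real^'n) set set" where
  "dyadic_grid \<alpha> = {dyadic_cube \<alpha> j k | j k. True}"

definition grid_shift :: "('n::finite \<Rightarrow> real) \<Rightarrow> bool" where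
  "grid_shift \<alpha> \<longleftrightarrow> (\<forall>i. \<alpha> i \<in> {0, 1/3, 2/3})"

definition sparse :: "real \<Rightarrow> (real^'n::finite) set set \<Rightarrow> bool" where
  "sparse \<eta> S \<longleftrightarrow> (\<exists>E. (\<forall>Q\<in>S. E Q \<subseteq> Q \<and> E Q \<in> sets lebesgue
                              \<and> \<eta> * measure lebesgue Q \<le> measure lebesgue (E Q))
                   \<and> (\<forall>Q\<in>S. \<forall>Q'\<in>S. Q \<noteq> Q' \<longrightarrow> E Q \<inter> E Q' = {}))"

text \<open>Exponents r in (0,infinity] are extended reals; r = infinity gives the supremum.
  S is assumed finite, so the supremum is a maximum (with value 0 off the union of S).\<close>
definition sparse_op :: "ereal \<Rightarrow> (real^'n::finite) set set \<Rightarrow> ((real^'n) set \<Rightarrow> real) \<Rightarrow> real^'n \<Rightarrow> real" where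
  "sparse_op r S a x =
     (if r = \<infinity> then Max (insert 0 {a Q | Q. Q \<in> S \<and> x \<in> Q})
      else (\<Sum>Q\<in>S. a Q powr (real_of_ereal r) * indicator Q x) powr (1 / real_of_ereal r))"

definition inv_exp :: "ereal \<Rightarrow> real" where
  "inv_exp r = (if r = \<infinity> then 0 else 1 / real_of_ereal r)"

definition cube :: "real^'n::finite \<Rightarrow> real \<Rightarrow> (real^'n) set" where
  "cube c l = {x. \<forall>i. c$i \<le> x$i \<and> x$i < c$i + l}"

definition cubes :: "(real^'n::finite) set set" where
  "cubes = {cube c l | c l. l > 0}"

definition wmeas :: "(real^'n::finite \<Rightarrow> real) \<Rightarrow> (real^'n) set \<Rightarrow> ennreal" where
  "wmeas w E = (\<integral>\<^sup>+ x\<in>E. ennreal (w x) \<partial>lebesgue)"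

definition maximal :: "(real^'n::finite \<Rightarrow> real) \<Rightarrow> real^'n \<Rightarrow> ennreal" where
  "maximal f x = (SUP Q\<in>{Q\<in>cubes. x \<in> Q}.
       (\<integral>\<^sup>+ y\<in>Q. ennreal \<bar>f y\<bar> \<partial>lebesgue) / emeasure lebesgue Q)"

definition is_weight :: "(real^'n::finite \<Rightarrow> real) \<Rightarrow> bool" where
  "is_weight w \<longleftrightarrow> w \<in> borel_measurable lebesgue \<and> (\<forall>x. 0 \<le> w x)
      \<and> (AE x in lebesgue. 0 < w x) \<and> (\<forall>a b. set_integrable lebesgue (cbox a b) w)"

definition FW_const :: "(real^'n::finite \<Rightarrow> real) \<Rightarrow> ennreal" where
  "FW_const w = (SUP Q\<in>cubes. (\<integral>\<^sup>+ x\<in>Q. maximal (\<lambda>y. w y * indicator Q y) x \<partial>lebesgue) / wmeas w Q)"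

definition A_FW :: "(real^'n::finite \<Rightarrow> real) \<Rightarrow> bool" where
  "A_FW w \<longleftrightarrow> is_weight w \<and> FW_const w < \<infinity>"

end

theory Submission
  imports Defs
begin

text \<open>
  Write $s = 2^{-j}/3$. The cells of side $s$ form a nested family in $j$, and every level-$j$ cube
  of the grid is a union of $3^d$ of them, so one can argue with the filtration generated by the cells.
  For a cell $K$, fold the space around $K$ back into $K$ by reflections. Folding is nonexpansive and
  fixes $K$, so a cube slightly enlarged around a folded point of $E_Q$ contains $Q \cap K$;
  hence the Fujii-Wilson condition bounds the sum of $w(Q \cap K)$ over the cubes $Q$ of
  $\mathcal S$ that are not coarser than $K$ by a multiple $L$ of $w(K)$, with
  $L = 14^d [w]_{FW} / \eta$.
  This Carleson condition, iterated from fine to coarse scales, gives the bound $2 w(K)$ for the integral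
  of $(1 + 1/(2L))^N$ over $K$, where $N$ counts these cubes.
  Finally stop at the first scale where the partial sum of $a_Q^q$ exceeds $\lambda^q$. On the set to be
  estimated the remaining cubes contribute more than $(2^q - 1)\lambda^q$ while $A^r$ is small,
  which forces $N \ge c/\gamma$, and the exponential moment applies on each stopping cell.
\<close>

subsection \<open>Cubes and folding\<close>

lemma measure_cube:
  fixes c :: "real^'n::finite"
  assumes "0 < l"
  shows "cube c l \<in> lmeasurable" "measure lebesgue (cube c l) = l ^ CARD('n)"
proof -
  let ?b = "\<chi> i. c$i + l"
  have sub: "box c ?b \<subseteq> cube c l" "cube c l \<subseteq> cbox c ?b"
    by (auto simp: cube_def mem_box_cart less_imp_le)
  have "negligible (cbox c ?b - box c ?b)"
    by (rule negligible_frontier_interval)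
  then have neg: "negligible (sym_diff (cbox c ?b) (cube c l))"
    by (rule negligible_subset) (use sub in auto)
  show "cube c l \<in> lmeasurable"
    by (rule lmeasurable_negligible_symdiff[OF lmeasurable_cbox neg])
  have "measure lebesgue (cube c l) = measure lebesgue (cbox c ?b)"
    by (rule measure_negligible_symdiff[OF lmeasurable_cbox neg])
  also have "\<dots> = l ^ CARD('n)"
    using assms by (simp add: content_cbox_cart interval_eq_empty_cart not_less less_imp_le)
  finally show "measure lebesgue (cube c l) = l ^ CARD('n)" .
qed

lemma emeasure_lebesgue_cube:
  fixes c :: "real^'n::finite"
  assumes "0 < l"
  shows "emeasure lebesgue (cube c l) = ennreal (l ^ CARD('n))"
  using measure_cube[OF assms, of c] by (simp add: emeasure_eq_measure2)

lemma sets_cube: "cube (c :: real^'n::finite) l \<in> sets lebesgue"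
proof (cases "0 < l")
  case True
  then show ?thesis using measure_cube(1) fmeasurableD by blast
next
  case False
  then have "cube c l = {}" by (force simp: cube_def)
  then show ?thesis by simp
qed

section \<open>Folding space into one cell by reflections\<close>

text \<open>On the translate of \<open>cube c s\<close> with index \<open>m\<close>, this is the
  composition of reflections in cell faces that carries it back to \<open>cube c s\<close>: an even
  index leaves a translation in that coordinate, an odd one a flip. For fixed \<open>m\<close> it is
  an affine isometry of the whole space.\<close>

definition fold_cell :: "real^'n::finite \<Rightarrow> real \<Rightarrow> ('n \<Rightarrow> int) \<Rightarrow> real^'n \<Rightarrow> real^'n" where
  "fold_cell c s m x =
     (\<chi> i. if even (m i) then x$i - s * m i else 2 * c$i + s * (m i + 1) - x$i)"

text \<open>The cells are open because a flip moves the closed end of a half-open side to the right,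
  outside the half-open \<open>cube c s\<close>.\<close>

definition open_cell :: "real^'n::finite \<Rightarrow> real \<Rightarrow> ('n \<Rightarrow> int) \<Rightarrow> (real^'n) set" where
  "open_cell c s m = {x. \<forall>i. c$i + s * m i < x$i \<and> x$i < c$i + s * (m i + 1)}"

lemma fold_cell_image:
  fixes c :: "real^'n::finite"
  assumes X: "X \<in> sets lebesgue"
  shows "fold_cell c s m ` X \<in> sets lebesgue"
    and "emeasure lebesgue (fold_cell c s m ` X) = emeasure lebesgue X"
proof -
  define sg where "sg = (\<lambda>i. if even (m i) then 1 else -1 :: real)"
  define t :: "real^'n" where "t = (\<chi> i. if even (m i) then s * m i else 2 * c$i + s * (m i + 1))"
  \<comment> \<open>The change of variables formula takes one scale factor per basis vector, so the
    sign is read off from the index of that vector. \<open>G\<close> is the inverse of the folding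
    map, which turns images into preimages.\<close>
  define sgb where "sgb = (\<lambda>j::real^'n. sg (THE i. j = axis i 1))"
  define G :: "real^'n \<Rightarrow> real^'n" where "G = (\<lambda>x. t + (\<Sum>j\<in>Basis. (sgb j * (x \<bullet> j)) *\<^sub>R j))"
  have sgb: "sgb (axis i 1) = sg i" for i
    by (simp add: sgb_def axis_eq_axis)
  have Gi: "G x $ i = (if even (m i) then x$i + s * m i else 2 * c$i + s * (m i + 1) - x$i)" for x i
  proof -
    have "G x $ i = t $ i + sgb (axis i 1) * (x \<bullet> axis i 1)"
    proof -
      have "(\<Sum>j\<in>Basis. (sgb j * (x \<bullet> j)) *\<^sub>R j) \<bullet> axis i 1 = sgb (axis i 1) * (x \<bullet> axis i 1)"
        by (simp add: inner_sum_left_Basis)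
      then show ?thesis by (simp add: G_def inner_axis)
    qed
    then show ?thesis by (simp add: sgb inner_axis) (simp add: sg_def t_def)
  qed
  have sgb1: "sgb j \<noteq> 0" "\<bar>sgb j\<bar> = 1" for j
    by (auto simp: sgb_def sg_def)
  have leb: "lebesgue = distr lebesgue lebesgue G"
    using lebesgue_affine_euclidean[of sgb t] sgb1 by (simp add: G_def density_1)
  have Gm: "G \<in> lebesgue \<rightarrow>\<^sub>M lebesgue"
    using lebesgue_affine_measurable[of sgb t] sgb1 by (simp add: G_def)
  have FG: "fold_cell c s m (G x) = x" "G (fold_cell c s m x) = x" for x
    by (auto simp: vec_eq_iff fold_cell_def Gi)
  have "x \<in> fold_cell c s m ` X" if "G x \<in> X" for x
    using imageI[OF that, of "fold_cell c s m"] by (simp add: FG)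
  then have im: "fold_cell c s m ` X = G -` X \<inter> space lebesgue"
    by (auto simp: FG)
  show "fold_cell c s m ` X \<in> sets lebesgue"
    unfolding im using Gm X by (rule measurable_sets)
  show "emeasure lebesgue (fold_cell c s m ` X) = emeasure lebesgue X"
    unfolding im using emeasure_distr[OF Gm X] leb by simp
qed

lemma inj_fold_cell: "inj (fold_cell c s m)"
proof (rule injI)
  fix x y assume e: "fold_cell c s m x = fold_cell c s m y"
  have "x $ i = y $ i" for i
    using arg_cong[OF e, of "\<lambda>v. v $ i"] by (auto simp: fold_cell_def split: if_splits)
  then show "x = y" by (simp add: vec_eq_iff)
qed

lemma fold_cell_in_cube:
  assumes x: "x \<in> open_cell c s m"
  shows "fold_cell c s m x \<in> cube c s"
  using x by (auto simp: open_cell_def fold_cell_def cube_def algebra_simps less_imp_le)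

text \<open>For index 1 or -1 the folding reflects in the face that separates \<open>x\<close> from
  \<open>z\<close>, which brings \<open>x\<close> closer. For an index of absolute value at least 2,
  \<open>x\<close> is farther than \<open>s\<close> from \<open>z\<close>, while two points of the
  cell differ by less than \<open>s\<close>.\<close>

lemma fold_cell_nonexpansive:
  assumes s: "0 < s" and x: "x \<in> open_cell c s m" and z: "z \<in> cube c s"
  shows "\<bar>fold_cell c s m x $ i - z $ i\<bar> \<le> \<bar>x $ i - z $ i\<bar>"
proof -
  let ?y = "fold_cell c s m x $ i"
  have x': "c$i + s * m i < x$i" "x$i < c$i + s * (m i + 1)"
    using x by (auto simp: open_cell_def)
  have z': "c$i \<le> z$i" "z$i < c$i + s" using z by (auto simp: cube_def)
  have y': "c$i \<le> ?y" "?y < c$i + s"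
    using fold_cell_in_cube[OF x] by (auto simp: cube_def)
  consider "m i = 0" | "m i = 1" | "m i \<ge> 2" | "m i = -1" | "m i \<le> -2" by linarith
  then show ?thesis
  proof cases
    case 3
    then have "s * 2 \<le> s * m i" using s by (intro mult_left_mono) auto
    then show ?thesis using x' y' z' by linarith
  next
    case 5
    then have "real_of_int (m i + 1) \<le> -1" by linarith
    then have "s * (m i + 1) \<le> s * -1" using s by (intro mult_left_mono) auto
    then show ?thesis using x' y' z' by linarith
  qed (use x' z' s in \<open>auto simp: fold_cell_def algebra_simps abs_if\<close>)
qed

text \<open>A point of \<open>cube b l\<close> is within \<open>3 * s\<close> of a point of the cell
  in each coordinate, so its offset from \<open>c\<close> lies strictly between
  \<open>-3 * s\<close> and \<open>4 * s\<close>. This leaves seven indices per coordinate;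
  \<open>N\<close> collects the separating hyperplanes.\<close>

lemma cube_subset_open_cells:
  fixes c :: "real^'n::finite"
  assumes s: "0 < s" and l: "l \<le> 3 * s" and meet: "cube b l \<inter> cube c s \<noteq> {}"
  shows "\<exists>N. negligible N \<and>
    cube b l \<subseteq> (\<Union>m \<in> (PiE UNIV (\<lambda>_. {-3..3})). open_cell c s m) \<union> N"
proof -
  let ?N = "\<Union>i. \<Union>m\<in>{-3..4::int}. {x::real^'n. x $ i = c$i + s * m}"
  have "negligible {x::real^'n. x $ i = t}" for i t
    using negligible_standard_hyperplane[of "axis i 1 :: real^'n" t] by (simp add: inner_axis)
  then have neg: "negligible ?N"
    by (intro negligible_Union ballI finite_imageI) (auto intro!: negligible_Union)
  obtain z where z: "z \<in> cube b l" "z \<in> cube c s" using meet by auto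
  have "x \<in> (\<Union>m \<in> (PiE UNIV (\<lambda>_. {-3..3})). open_cell c s m)"
    if x: "x \<in> cube b l" and xN: "x \<notin> ?N" for x
  proof -
    define m where "m = (\<lambda>i. \<lfloor>(x$i - c$i) / s\<rfloor>)"
    have xz: "\<bar>x $ i - z $ i\<bar> < 3 * s" for i
      using x z(1) l by (auto simp: cube_def abs_if) (smt (verit, best))+
    have rng: "- 3 * s < x$i - c$i" "x$i - c$i < 4 * s" for i
    proof -
      have "c$i \<le> z$i" "z$i < c$i + s" using z(2) by (auto simp: cube_def)
      then show "- 3 * s < x$i - c$i" "x$i - c$i < 4 * s"
        using xz[of i] by linarith+
    qed
    have m: "m i \<in> {-3..3}" for i
    proof -
      have "-3 < (x$i - c$i) / s" "(x$i - c$i) / s < 4"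
        using rng[of i] s by (simp_all add: field_simps)
      then show ?thesis unfolding m_def by (auto simp: le_floor_iff floor_le_iff)
    qed
    have fl: "c$i + s * m i \<le> x$i" "x$i < c$i + s * (m i + 1)" for i
    proof -
      have "m i \<le> (x$i - c$i) / s" "(x$i - c$i) / s < m i + 1"
        unfolding m_def by linarith+
      then show "c$i + s * m i \<le> x$i" "x$i < c$i + s * (m i + 1)"
        using s by (simp_all add: field_simps)
    qed
    have "x$i \<noteq> c$i + s * m i" for i
    proof -
      have "m i \<in> {-3..4}" using m[of i] by auto
      then show ?thesis using xN by blast
    qed
    then have "x \<in> open_cell c s m"
      using fl unfolding open_cell_def mem_Collect_eq by (metis order_le_imp_less_or_eq)
    then show ?thesis using m by (intro UN_I[of m]) auto
  qed
  then show ?thesis using neg by blast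
qed

subsection \<open>The Carleson condition on a cube\<close>

lemma wmeas_mono: "A \<subseteq> B \<Longrightarrow> wmeas w A \<le> wmeas w B"
  unfolding wmeas_def by (intro nn_integral_mono) (auto split: split_indicator)

lemma wmeas_cube:
  fixes w :: "real^'n::finite \<Rightarrow> real"
  assumes w: "is_weight w" and l: "0 < l"
  shows "wmeas w (cube c l) \<noteq> 0" "wmeas w (cube c l) \<noteq> \<infinity>"
proof -
  have wm [measurable]: "w \<in> borel_measurable lebesgue" and w0: "\<And>x. 0 \<le> w x"
    and wpos: "AE x in lebesgue. 0 < w x"
    using w by (auto simp: is_weight_def)
  have [measurable]: "cube c l \<in> sets lebesgue" by (rule sets_cube)
  show "wmeas w (cube c l) \<noteq> 0"
  proof
    assume "wmeas w (cube c l) = 0"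
    then have "AE x in lebesgue. ennreal (w x) * indicator (cube c l) x = 0"
      unfolding wmeas_def by (subst (asm) nn_integral_0_iff_AE) auto
    with wpos have "AE x in lebesgue. x \<notin> cube c l"
      by eventually_elim (auto split: split_indicator_asm)
    then have "emeasure lebesgue (cube c l) = 0"
      by (subst (asm) AE_iff_measurable[where N = "cube c l"]) auto
    then show False using emeasure_lebesgue_cube[OF l, of c] l by simp
  qed
  let ?B = "cbox c (\<chi> i. c$i + l)"
  have "integrable lebesgue (\<lambda>x. indicator ?B x *\<^sub>R w x)"
    using w by (auto simp: is_weight_def set_integrable_def)
  then have "(\<integral>\<^sup>+ x. ennreal (norm (indicator ?B x *\<^sub>R w x)) \<partial>lebesgue) < \<infinity>"
    by (simp add: integrable_iff_bounded)
  moreover have "wmeas w (cube c l) \<le> (\<integral>\<^sup>+ x. ennreal (norm (indicator ?B x *\<^sub>R w x)) \<partial>lebesgue)"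
    unfolding wmeas_def
    by (intro nn_integral_mono)
       (auto split: split_indicator simp: cube_def mem_box_cart w0 less_imp_le)
  ultimately show "wmeas w (cube c l) \<noteq> \<infinity>" by auto
qed

text \<open>The denominator in \<open>FW_const\<close> can be cleared in \<open>ennreal\<close>
  because the weight of a cube is neither 0 nor infinite.\<close>

lemma maximal_integral_le:
  fixes w :: "real^'n::finite \<Rightarrow> real"
  assumes w: "is_weight w" and l: "0 < l"
  shows "(\<integral>\<^sup>+ x\<in>cube c l. maximal (\<lambda>y. w y * indicator (cube c l) y) x \<partial>lebesgue)
    \<le> FW_const w * wmeas w (cube c l)" (is "?I \<le> _")
proof -
  have "cube c l \<in> cubes" using l by (auto simp: cubes_def)
  then have "?I / wmeas w (cube c l) \<le> FW_const w"
    unfolding FW_const_def by (rule SUP_upper)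
  then have "?I / wmeas w (cube c l) * wmeas w (cube c l) \<le> FW_const w * wmeas w (cube c l)"
    by (rule mult_right_mono) simp
  then show ?thesis
    using wmeas_cube[OF w l, of c] by (simp add: ennreal_divide_times top.not_eq_extremum)
qed

lemma maximal_ge:
  fixes w :: "real^'n::finite \<Rightarrow> real"
  assumes w: "is_weight w" and l: "0 < l" and x: "x \<in> cube c l"
    and A: "A \<subseteq> cube c l \<inter> K"
  shows "wmeas w A / ennreal (l ^ CARD('n)) \<le> maximal (\<lambda>y. w y * indicator K y) x"
proof -
  have w0: "\<And>x. 0 \<le> w x" using w by (auto simp: is_weight_def)
  have "wmeas w A \<le> (\<integral>\<^sup>+ y\<in>cube c l. ennreal \<bar>w y * indicator K y\<bar> \<partial>lebesgue)"
    unfolding wmeas_def using A w0 by (intro nn_integral_mono) (auto split: split_indicator)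
  then have "wmeas w A / ennreal (l ^ CARD('n)) \<le>
      (\<integral>\<^sup>+ y\<in>cube c l. ennreal \<bar>w y * indicator K y\<bar> \<partial>lebesgue) / emeasure lebesgue (cube c l)"
    unfolding emeasure_lebesgue_cube[OF l] by (rule divide_right_mono_ennreal)
  also have "\<dots> \<le> maximal (\<lambda>y. w y * indicator K y) x"
    unfolding maximal_def by (rule SUP_upper) (use l x in \<open>auto simp: cubes_def\<close>)
  finally show ?thesis .
qed

text \<open>On the unit cube the maximal function is at least the average of \<open>w\<close>, the
  cube itself being one of the competitors; since its volume is 1, integrating returns the weight of
  the cube. The bound keeps the Carleson constant at least 1 later on.\<close>

lemma FW_const_ge_1:
  fixes w :: "real^'n::finite \<Rightarrow> real"
  assumes w: "is_weight w"
  shows "1 \<le> FW_const w"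
proof -
  let ?K = "cube (0::real^'n) 1"
  note K = wmeas_cube[OF w zero_less_one, of "0::real^'n"]
  have [measurable]: "?K \<in> sets lebesgue" by (rule sets_cube)
  have "wmeas w ?K = (\<integral>\<^sup>+ x. wmeas w ?K * indicator ?K x \<partial>lebesgue)"
    using emeasure_lebesgue_cube[OF zero_less_one, of "0::real^'n"]
    by (subst nn_integral_cmult_indicator) (auto simp del: emeasure_completion)
  also have "\<dots> \<le> (\<integral>\<^sup>+ x\<in>?K. maximal (\<lambda>y. w y * indicator ?K y) x \<partial>lebesgue)"
    using maximal_ge[OF w zero_less_one, of _ "0::real^'n" ?K ?K]
    by (intro nn_integral_mono) (auto simp: divide_ennreal_def split: split_indicator)
  also have "\<dots> \<le> FW_const w * wmeas w ?K"
    by (rule maximal_integral_le[OF w zero_less_one])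
  finally have "wmeas w ?K / wmeas w ?K \<le> FW_const w * wmeas w ?K / wmeas w ?K"
    by (rule divide_right_mono_ennreal)
  then show ?thesis using K by (simp add: ennreal_mult_divide_eq top.not_eq_extremum)
qed

lemma sets_open_cell: "open_cell (c :: real^'n::finite) s m \<in> sets lebesgue"
proof -
  have "open_cell c s m = box (\<chi> i. c$i + s * m i) (\<chi> i. c$i + s * (m i + 1))"
    by (auto simp: open_cell_def mem_box_cart)
  then show ?thesis by simp
qed

text \<open>The part of \<open>E Q\<close> in another cell lies where the Fujii-Wilson integral over
  \<open>cube c s\<close> does not see it. Its folded copy \<open>F Q\<close> does lie in
  \<open>cube c s\<close>, has the same measure, stays disjoint from the other copies because one
  injective map folds them all, and carries the lower bound \<open>v Q\<close> for the maximal
  function.\<close>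

lemma carleson_open_cell:
  fixes w :: "real^'n::finite \<Rightarrow> real"
  assumes w: "is_weight w" and s: "0 < s" and fin: "finite S"
    and Q: "\<And>Q. Q \<in> S \<Longrightarrow> 0 < l Q \<and> Q = cube (b Q) (l Q)"
    and E: "\<And>Q. Q \<in> S \<Longrightarrow> E Q \<subseteq> Q \<and> E Q \<in> sets lebesgue"
    and disj: "\<And>Q Q'. Q \<in> S \<Longrightarrow> Q' \<in> S \<Longrightarrow> Q \<noteq> Q' \<Longrightarrow> E Q \<inter> E Q' = {}"
  shows "(\<Sum>Q\<in>S. wmeas w (Q \<inter> cube c s) / ennreal ((2 * l Q) ^ CARD('n))
             * emeasure lebesgue (E Q \<inter> open_cell c s m))
    \<le> FW_const w * wmeas w (cube c s)"
proof -
  define F where "F = (\<lambda>Q. fold_cell c s m ` (E Q \<inter> open_cell c s m))"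
  define v where "v = (\<lambda>Q. wmeas w (Q \<inter> cube c s) / ennreal ((2 * l Q) ^ CARD('n)))"
  let ?M = "maximal (\<lambda>y. w y * indicator (cube c s) y)"
  have F: "F Q \<in> sets lebesgue" "emeasure lebesgue (F Q) = emeasure lebesgue (E Q \<inter> open_cell c s m)"
    if "Q \<in> S" for Q
    unfolding F_def using E[OF that] sets_open_cell[of c s m]
    by (intro fold_cell_image sets.Int; auto)+
  have FK: "F Q \<subseteq> cube c s" for Q
    unfolding F_def using fold_cell_in_cube by blast
  have Fdisj: "F Q \<inter> F Q' = {}" if "Q \<in> S" "Q' \<in> S" "Q \<noteq> Q'" for Q Q'
    unfolding F_def using disj[OF that] inj_fold_cell[of c s m]
    by (subst image_Int[symmetric]) auto
  have vM: "v Q \<le> ?M y" if QS: "Q \<in> S" and y: "y \<in> F Q" for Q y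
  proof -
    obtain x where x: "x \<in> E Q" "x \<in> open_cell c s m" "y = fold_cell c s m x"
      using y unfolding F_def by auto
    have xQ: "x \<in> cube (b Q) (l Q)" and l: "0 < l Q" and Qeq: "Q = cube (b Q) (l Q)"
      using x(1) E[OF QS] Q[OF QS] by auto
    \<comment> \<open>The cube of side \<open>2 * l Q\<close> centred at the folded point
      \<open>y\<close>. It contains \<open>Q \<inter> cube c s\<close>, since \<open>x\<close> is
      within \<open>l Q\<close> of each such point and folding does not increase the distance; the
      doubled side is the one in \<open>v Q\<close>.\<close>
    let ?c = "\<chi> i. y $ i - l Q"
    have sub: "Q \<inter> cube c s \<subseteq> cube ?c (2 * l Q) \<inter> cube c s"
    proof
      fix z assume z: "z \<in> Q \<inter> cube c s"
      have "\<bar>y $ i - z $ i\<bar> < l Q" for i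
      proof -
        have "z \<in> cube (b Q) (l Q)" using z Qeq by simp
        then have "\<bar>x $ i - z $ i\<bar> < l Q"
          using xQ unfolding cube_def by (smt (verit) mem_Collect_eq)
        then show ?thesis
          using fold_cell_nonexpansive[OF s x(2), of z i] z x(3) by simp
      qed
      then show "z \<in> cube ?c (2 * l Q) \<inter> cube c s"
        using z by (auto simp: cube_def abs_less_iff) (smt (verit))+
    qed
    have "y \<in> cube ?c (2 * l Q)" using l by (auto simp: cube_def)
    from maximal_ge[OF w _ this sub] l show ?thesis by (simp add: v_def)
  qed
  have "(\<Sum>Q\<in>S. v Q * emeasure lebesgue (E Q \<inter> open_cell c s m))
      = (\<Sum>Q\<in>S. \<integral>\<^sup>+ y. v Q * indicator (F Q) y \<partial>lebesgue)"
    using F by (intro sum.cong refl) (simp add: nn_integral_cmult_indicator)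
  also have "\<dots> = (\<integral>\<^sup>+ y. (\<Sum>Q\<in>S. v Q * indicator (F Q) y) \<partial>lebesgue)"
    using F by (intro nn_integral_sum[symmetric]) auto
  also have "\<dots> \<le> (\<integral>\<^sup>+ y\<in>cube c s. ?M y \<partial>lebesgue)"
  proof (intro nn_integral_mono)
    fix y
    show "(\<Sum>Q\<in>S. v Q * indicator (F Q) y) \<le> ?M y * indicator (cube c s) y"
    proof (cases "\<exists>Q\<in>S. y \<in> F Q")
      case True
      then obtain P where P: "P \<in> S" "y \<in> F P" by auto
      \<comment> \<open>By disjointness only one \<open>F Q\<close> contains \<open>y\<close>, so
        the sum has a single nonzero term.\<close>
      have "(\<Sum>Q\<in>S. v Q * indicator (F Q) y) = (\<Sum>Q\<in>S. if Q = P then v P else 0)"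
        using P Fdisj by (intro sum.cong) (auto split: split_indicator)
      also have "\<dots> = v P" using P fin by simp
      also have "\<dots> \<le> ?M y * indicator (cube c s) y" using vM[OF P] FK[of P] P by auto
      finally show ?thesis .
    next
      case False
      then have "(\<Sum>Q\<in>S. v Q * indicator (F Q) y) = 0" by (intro sum.neutral) auto
      then show ?thesis by simp
    qed
  qed
  also have "\<dots> \<le> FW_const w * wmeas w (cube c s)"
    by (rule maximal_integral_le[OF w s])
  finally show ?thesis by (simp add: v_def)
qed

text \<open>Sparseness spreads at least \<open>\<eta>\<close> times the volume of \<open>Q\<close>
  over the cells near \<open>cube c s\<close>, and each cell is handled by
  \<open>carleson_open_cell\<close>. The constant is 7 cells per dimension times 2 for the doubled
  side.\<close>

lemma carleson_cube:
  fixes w :: "real^'n::finite \<Rightarrow> real"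
  assumes w: "is_weight w" and s: "0 < s" and fin: "finite S" and eta: "0 < \<eta>"
    and Q: "\<And>Q. Q \<in> S \<Longrightarrow> 0 < l Q \<and> l Q \<le> 3 * s \<and> Q = cube (b Q) (l Q)"
    and E: "\<And>Q. Q \<in> S \<Longrightarrow> E Q \<subseteq> Q \<and> E Q \<in> sets lebesgue \<and>
              \<eta> * measure lebesgue Q \<le> measure lebesgue (E Q)"
    and disj: "\<And>Q Q'. Q \<in> S \<Longrightarrow> Q' \<in> S \<Longrightarrow> Q \<noteq> Q' \<Longrightarrow> E Q \<inter> E Q' = {}"
  shows "ennreal \<eta> * (\<Sum>Q\<in>S. wmeas w (Q \<inter> cube c s))
    \<le> 14 ^ CARD('n) * (FW_const w * wmeas w (cube c s))"
proof -
  define v where "v = (\<lambda>Q. wmeas w (Q \<inter> cube c s) / ennreal ((2 * l Q) ^ CARD('n)))"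
  define X where "X = (PiE (UNIV::'n set) (\<lambda>_. {-3..3::int}))"
  have finX: "finite X" and cardX: "card X = 7 ^ CARD('n)"
    by (auto simp: X_def card_PiE intro: finite_PiE)
  have step: "ennreal \<eta> * wmeas w (Q \<inter> cube c s)
      \<le> 2 ^ CARD('n) * (\<Sum>m\<in>X. v Q * emeasure lebesgue (E Q \<inter> open_cell c s m))"
    if QS: "Q \<in> S" for Q
  \<comment> \<open>A cube that misses \<open>cube c s\<close> need not be covered by the chosen
    cells, but its term on the left is 0.\<close>
  proof (cases "Q \<inter> cube c s = {}")
    case True
    then show ?thesis by (simp add: wmeas_def)
  next
    case False
    have l: "0 < l Q" "l Q \<le> 3 * s" and Qeq: "Q = cube (b Q) (l Q)"
      using Q[OF QS] by auto
    have EQ: "E Q \<subseteq> Q" and [measurable]: "E Q \<in> sets lebesgue"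
      and mE: "\<eta> * measure lebesgue Q \<le> measure lebesgue (E Q)"
      using E[OF QS] by auto
    have Qm: "Q \<in> lmeasurable" "measure lebesgue Q = l Q ^ CARD('n)"
      using measure_cube[OF l(1), of "b Q"] Qeq by auto
    have "E Q \<in> lmeasurable" using Qm(1) EQ by (rule fmeasurableI2) simp
    then have "emeasure lebesgue (E Q) = measure lebesgue (E Q)"
      by (simp add: emeasure_eq_measure2)
    then have big: "ennreal (\<eta> * l Q ^ CARD('n)) \<le> emeasure lebesgue (E Q)"
      using mE Qm(2) by (simp add: ennreal_leI)
    obtain N where N: "negligible N" "Q \<subseteq> (\<Union>m\<in>X. open_cell c s m) \<union> N"
      using cube_subset_open_cells[OF s l(2), of "b Q" c] False Qeq unfolding X_def by auto
    have Nn: "N \<in> null_sets lebesgue" using N(1) by (simp add: negligible_iff_null_sets)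
    have [measurable]: "open_cell c s m \<in> sets lebesgue" for m by (rule sets_open_cell)
    have "emeasure lebesgue (E Q) \<le> emeasure lebesgue ((\<Union>m\<in>X. E Q \<inter> open_cell c s m) \<union> N)"
      using EQ N(2) Nn finX by (intro emeasure_mono) auto
    also have "\<dots> = emeasure lebesgue (\<Union>m\<in>X. E Q \<inter> open_cell c s m)"
      using Nn finX by (intro emeasure_Un_null_set) auto
    also have "\<dots> \<le> (\<Sum>m\<in>X. emeasure lebesgue (E Q \<inter> open_cell c s m))"
      using finX by (intro emeasure_subadditive_finite) auto
    finally have cover: "ennreal (\<eta> * l Q ^ CARD('n)) \<le> (\<Sum>m\<in>X. emeasure lebesgue (E Q \<inter> open_cell c s m))"
      using big by (rule order_trans[rotated])
    have "ennreal \<eta> * wmeas w (Q \<inter> cube c s)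
        = wmeas w (Q \<inter> cube c s) * (ennreal (2 ^ CARD('n) * (\<eta> * l Q ^ CARD('n))) / ennreal ((2 * l Q) ^ CARD('n)))"
      using l eta by (subst divide_ennreal) (auto simp: power_mult_distrib mult.commute)
    also have "\<dots> = 2 ^ CARD('n) * (v Q * ennreal (\<eta> * l Q ^ CARD('n)))"
      using l eta unfolding v_def
      by (simp add: ennreal_mult ennreal_times_divide ennreal_divide_times ennreal_power[symmetric] ac_simps)
    also have "\<dots> \<le> 2 ^ CARD('n) * (v Q * (\<Sum>m\<in>X. emeasure lebesgue (E Q \<inter> open_cell c s m)))"
      by (intro mult_left_mono cover) auto
    finally show ?thesis by (simp add: sum_distrib_left)
  qed
  have "ennreal \<eta> * (\<Sum>Q\<in>S. wmeas w (Q \<inter> cube c s))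
      \<le> (\<Sum>Q\<in>S. 2 ^ CARD('n) * (\<Sum>m\<in>X. v Q * emeasure lebesgue (E Q \<inter> open_cell c s m)))"
    by (subst sum_distrib_left) (intro sum_mono step)
  also have "\<dots> = 2 ^ CARD('n) * (\<Sum>m\<in>X. \<Sum>Q\<in>S. v Q * emeasure lebesgue (E Q \<inter> open_cell c s m))"
    unfolding sum_distrib_left[symmetric]
    by (subst sum.swap) (simp add: sum_distrib_left)
  also have "\<dots> \<le> 2 ^ CARD('n) * (\<Sum>m\<in>X. FW_const w * wmeas w (cube c s))"
    unfolding v_def using Q E disj
    by (intro mult_left_mono sum_mono carleson_open_cell[OF w s fin]) auto
  also have "\<dots> = 14 ^ CARD('n) * (FW_const w * wmeas w (cube c s))"
  proof -
    have "(14::ennreal) ^ CARD('n) = 2 ^ CARD('n) * 7 ^ CARD('n)"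
      by (simp flip: power_mult_distrib)
    then show ?thesis by (simp add: cardX mult.assoc)
  qed
  finally show ?thesis .
qed

subsection \<open>Exponential moments and counting\<close>

lemma power_card_filter:
  fixes u :: "'b::comm_monoid_mult"
  assumes "finite J"
  shows "u ^ card {j\<in>J. P j} = (\<Prod>j\<in>J. if P j then u else 1)"
proof -
  have "(\<Prod>j\<in>J. if P j then u else 1) = (\<Prod>j\<in>{j\<in>J. P j}. u)"
    using assms by (rule prod.inter_filter[symmetric])
  then show ?thesis by simp
qed

text \<open>The geometric sum, written without subtraction so that it applies in
  \<open>ennreal\<close>. Ordering \<open>J\<close> lets each summand depend only on the elements
  above \<open>j\<close>, that is, on finer scales.\<close>

lemma power_card_telescope:
  fixes e :: "'b::comm_semiring_1" and J :: "'c::linorder set"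
  assumes "finite J"
  shows "(1 + e) ^ card J = 1 + e * (\<Sum>j\<in>J. (1 + e) ^ card {k\<in>J. j < k})"
  using assms
proof (induction J rule: finite_linorder_min_induct)
  case empty
  then show ?case by simp
next
  case (insert b A)
  have b: "b \<notin> A" using insert by auto
  have "{k \<in> insert b A. b < k} = A" using insert by auto
  moreover have "{k \<in> insert b A. j < k} = {k \<in> A. j < k}" if "j \<in> A" for j
    using insert that by auto
  ultimately have "(\<Sum>j\<in>insert b A. (1 + e) ^ card {k\<in>insert b A. j < k})
      = (1 + e) ^ card A + (\<Sum>j\<in>A. (1 + e) ^ card {k\<in>A. j < k})"
    using insert.hyps(1) b by simp
  moreover have "(1 + e) ^ card (insert b A) = (1 + e) ^ card A + e * (1 + e) ^ card A"
    using insert.hyps(1) b by (simp add: algebra_simps)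
  ultimately show ?case
    using insert.IH by (simp add: algebra_simps)
qed

text \<open>Induction on the number of remaining levels. Telescoping reduces the integral over
  \<open>A\<close> to integrals over \<open>A \<inter> U j\<close> that involve only levels above
  \<open>j\<close>; by induction these are at most twice the measure, and the Carleson hypothesis
  bounds their sum by \<open>2 * L\<close> times the measure of \<open>A\<close>. With
  \<open>2 * (e * L) \<le> 1\<close> the factor 2 reproduces itself.\<close>

lemma exponential_moment:
  fixes M :: "'a measure" and \<A> :: "int \<Rightarrow> 'a set set" and e L :: ennreal
  assumes sets: "\<And>i A. A \<in> \<A> i \<Longrightarrow> A \<in> sets M"
    and mono: "\<And>i j. i \<le> j \<Longrightarrow> \<A> i \<subseteq> \<A> j"
    and Int: "\<And>i A B. A \<in> \<A> i \<Longrightarrow> B \<in> \<A> i \<Longrightarrow> A \<inter> B \<in> \<A> i"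
    and J: "finite J" and U: "\<And>j. j \<in> J \<Longrightarrow> U j \<in> \<A> j"
    and carleson: "\<And>i A. A \<in> \<A> i \<Longrightarrow> (\<Sum>j\<in>{j\<in>J. i \<le> j}. emeasure M (A \<inter> U j)) \<le> L * emeasure M A"
    and eL: "2 * (e * L) \<le> 1"
    and A: "A \<in> \<A> i"
  shows "(\<integral>\<^sup>+x\<in>A. (1 + e) ^ card {j\<in>J. i \<le> j \<and> x \<in> U j} \<partial>M) \<le> 2 * emeasure M A"
  using A
proof (induction "card {j\<in>J. i \<le> j}" arbitrary: i A rule: less_induct)
  case less
  let ?g = "\<lambda>i x. (1 + e) ^ card {j\<in>J. i \<le> j \<and> x \<in> U j}"
  let ?J = "{j\<in>J. i \<le> j}"
  have [measurable]: "A \<in> sets M" using less.prems sets by blast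
  have U': "U j \<in> sets M" if "j \<in> J" for j using U[OF that] sets by blast
  have g: "?g i x = (\<Prod>j\<in>{j\<in>J. i \<le> j}. if x \<in> U j then 1 + e else 1)" for i x
    using power_card_filter[of "{j\<in>J. i \<le> j}" "1 + e" "\<lambda>j. x \<in> U j"] J by (simp add: conj_assoc)
  have meas [measurable]: "?g i \<in> borel_measurable M" for i
  proof -
    have "(\<lambda>x. if x \<in> U j then 1 + e else 1) \<in> borel_measurable M" if "j \<in> {j\<in>J. i \<le> j}" for j
      using U'[of j] that by (intro measurable_If_set) auto
    then show ?thesis unfolding g by (rule borel_measurable_prod_ennreal)
  qed
  \<comment> \<open>Passing to \<open>j + 1\<close> removes \<open>j\<close> from the index set, so
    the induction measure drops, and \<open>A \<inter> U j\<close>, being in the class of level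
    \<open>j\<close>, is also in that of level \<open>j + 1\<close>.\<close>
  have IH: "(\<integral>\<^sup>+x\<in>A \<inter> U j. ?g (j + 1) x \<partial>M) \<le> 2 * emeasure M (A \<inter> U j)" if j: "j \<in> ?J" for j
  proof (rule less.hyps)
    have "{k\<in>J. j + 1 \<le> k} \<subset> ?J" using j by force
    then show "card {k\<in>J. j + 1 \<le> k} < card ?J" using J by (intro psubset_card_mono) auto
    have "A \<in> \<A> j" "U j \<in> \<A> j" using mono[of i j] less.prems U j by auto
    then show "A \<inter> U j \<in> \<A> (j + 1)" using Int mono[of j "j + 1"] by auto
  qed
  have pt: "?g i x = 1 + e * (\<Sum>j\<in>?J. ?g (j + 1) x * indicator (U j) x)" for x
  proof -
    have fin: "finite {j\<in>J. i \<le> j \<and> x \<in> U j}" using J by auto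
    have "?g i x = 1 + e * (\<Sum>j\<in>{j\<in>J. i \<le> j \<and> x \<in> U j}.
        (1 + e) ^ card {k \<in> {j\<in>J. i \<le> j \<and> x \<in> U j}. j < k})"
      by (rule power_card_telescope[OF fin])
    also have "(\<Sum>j\<in>{j\<in>J. i \<le> j \<and> x \<in> U j}. (1 + e) ^ card {k \<in> {j\<in>J. i \<le> j \<and> x \<in> U j}. j < k})
        = (\<Sum>j\<in>{j\<in>?J. x \<in> U j}. ?g (j + 1) x)"
      by (intro sum.cong arg_cong[where f = "\<lambda>C. (1 + e) ^ card C"]) auto
    also have "\<dots> = (\<Sum>j\<in>?J. if x \<in> U j then ?g (j + 1) x else 0)"
      using J by (intro sum.inter_filter) auto
    also have "\<dots> = (\<Sum>j\<in>?J. ?g (j + 1) x * indicator (U j) x)"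
      by (intro sum.cong) auto
    finally show ?thesis .
  qed
  have "(\<integral>\<^sup>+x\<in>A. ?g i x \<partial>M)
      = (\<integral>\<^sup>+x. indicator A x + e * (\<Sum>j\<in>?J. ?g (j + 1) x * indicator (A \<inter> U j) x) \<partial>M)"
    by (intro nn_integral_cong, subst pt)
       (auto split: split_indicator intro!: arg_cong[where f = "\<lambda>t. e * t"] sum.cong)
  also have "\<dots> = emeasure M A + e * (\<Sum>j\<in>?J. \<integral>\<^sup>+x\<in>A \<inter> U j. ?g (j + 1) x \<partial>M)"
  proof -
    have [measurable]: "(\<lambda>x. ?g (j + 1) x * indicator (A \<inter> U j) x) \<in> borel_measurable M" if "j \<in> ?J" for j
      using U'[of j] that by (intro borel_measurable_times_ennreal meas borel_measurable_indicator) auto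
    show ?thesis
      by (subst nn_integral_add; (subst nn_integral_cmult)?; (subst nn_integral_sum)?) auto
  qed
  also have "\<dots> \<le> emeasure M A + e * (\<Sum>j\<in>?J. 2 * emeasure M (A \<inter> U j))"
    by (intro add_left_mono mult_left_mono sum_mono IH) auto
  also have "\<dots> \<le> emeasure M A + e * (2 * (L * emeasure M A))"
    unfolding sum_distrib_left[symmetric]
    by (intro add_left_mono mult_left_mono carleson less.prems) auto
  also have "\<dots> = emeasure M A + 2 * (e * L) * emeasure M A" by (simp add: ac_simps)
  also have "\<dots> \<le> emeasure M A + 1 * emeasure M A"
    by (intro add_left_mono mult_right_mono eL) auto
  finally show ?case by (simp add: mult_2)
qed

section \<open>Counting the terms of a sum of powers\<close>

text \<open>A large sum of \<open>q\<close>-th powers together with a small \<open>r\<close>-norm of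
  the same numbers is possible only with many terms. The constant \<open>c\<close> depends on
  \<open>q\<close>, \<open>r\<close> and \<open>D\<close> alone.\<close>

lemma card_lower_bound:
  fixes r :: ereal and q D :: real
  assumes q: "0 < q" "ereal q < r" and D: "0 < D"
  shows "\<exists>c>0. \<forall>S a (x::real^'n::finite) F lam \<gamma>.
    finite S \<longrightarrow> (\<forall>Q\<in>S. 0 < a Q) \<longrightarrow> F \<subseteq> {Q\<in>S. x \<in> Q} \<longrightarrow> 0 < lam \<longrightarrow> 0 < \<gamma> \<longrightarrow>
    sparse_op r S a x \<le> \<gamma> powr (1 / q - inv_exp r) * lam \<longrightarrow>
    D * lam powr q < (\<Sum>Q\<in>F. a Q powr q) \<longrightarrow> c / \<gamma> \<le> real (card F)"
proof (cases "r = \<infinity>")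
  case True
  show ?thesis
  proof (intro exI[of _ D] conjI allI impI D)
    fix S a and x :: "real^'n" and F lam \<gamma>
    assume fin: "finite S" and pos: "\<forall>Q\<in>S. 0 < a Q" and F: "F \<subseteq> {Q\<in>S. x \<in> Q}"
      and lam: "0 < lam" and g: "0 < (\<gamma>::real)"
      and up: "sparse_op r S a x \<le> \<gamma> powr (1 / q - inv_exp r) * lam"
      and low: "D * lam powr q < (\<Sum>Q\<in>F. a Q powr q)"
    have "{a Q |Q. Q \<in> S \<and> x \<in> Q} \<subseteq> a ` S" by auto
    then have finI: "finite (insert 0 {a Q |Q. Q \<in> S \<and> x \<in> Q})"
      using fin by (auto intro: finite_subset)
    have "a Q powr q \<le> \<gamma> * lam powr q" if "Q \<in> F" for Q
    proof -
      have "a Q \<le> sparse_op r S a x"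
        unfolding sparse_op_def using True that F finI by (auto intro!: Max_ge)
      also have "\<dots> \<le> \<gamma> powr (1 / q) * lam" using up True by (simp add: inv_exp_def)
      finally have "a Q powr q \<le> (\<gamma> powr (1 / q) * lam) powr q"
        using pos that F q by (intro powr_mono2) (auto intro: less_imp_le)
      also have "\<dots> = \<gamma> * lam powr q" using q g by (simp add: powr_mult powr_powr)
      finally show ?thesis .
    qed
    then have "(\<Sum>Q\<in>F. a Q powr q) \<le> real (card F) * (\<gamma> * lam powr q)"
      by (rule sum_bounded_above)
    with low have "D * lam powr q < (real (card F) * \<gamma>) * lam powr q" by (simp add: mult.assoc)
    then have "D < real (card F) * \<gamma>" using lam by simp
    then show "D / \<gamma> \<le> real (card F)" using g by (simp add: field_simps)
  qed
next
  case False
  then obtain r' where r: "r = ereal r'" using q by (cases r) auto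
  have qr: "q < r'" "0 < r'" using q r by auto
  \<comment> \<open>This is \<open>D / 2\<close> to the power \<open>r' / (r' - q)\<close>, the
    value that results from the choice of \<open>u\<close> below.\<close>
  define c where "c = (D / 2) * (D / 2) powr (q / (r' - q))"
  show ?thesis
  proof (intro exI[of _ c] conjI allI impI)
    show "0 < c" using D by (simp add: c_def)
    fix S a and x :: "real^'n" and F lam \<gamma>
    assume fin: "finite S" and pos: "\<forall>Q\<in>S. 0 < a Q" and F: "F \<subseteq> {Q\<in>S. x \<in> Q}"
      and lam: "0 < lam" and g: "0 < (\<gamma>::real)"
      and up: "sparse_op r S a x \<le> \<gamma> powr (1 / q - inv_exp r) * lam"
      and low: "D * lam powr q < (\<Sum>Q\<in>F. a Q powr q)"
    define R where "R = (\<Sum>Q\<in>F. a Q powr r')"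
    \<comment> \<open>The height at which the bound for \<open>R * u powr (q - r')\<close> equals
      half of \<open>D * lam powr q\<close>; the other half must then come from
      \<open>card F\<close> terms of size at most \<open>u powr q\<close>.\<close>
    define u where "u = lam * \<gamma> powr (1 / q) * (D / 2) powr (- 1 / (r' - q))"
    have u0: "0 < u" using lam g D by (simp add: u_def)
    have finF: "finite F" using finite_subset[OF F] fin by simp
    have "R \<le> (\<Sum>Q\<in>S. a Q powr r' * indicator Q x)"
      unfolding R_def using F fin finF by (intro sum_le_included[where i = id]) auto
    then have "R powr (1 / r') \<le> sparse_op r S a x"
      unfolding sparse_op_def using r qr
      by (auto intro!: powr_mono2 sum_nonneg simp: R_def)
    then have "R powr (1 / r') \<le> \<gamma> powr (1 / q - 1 / r') * lam"
      using up r by (simp add: inv_exp_def)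
    then have "(R powr (1 / r')) powr r' \<le> (\<gamma> powr (1 / q - 1 / r') * lam) powr r'"
      using qr by (intro powr_mono2) auto
    moreover have "(1 / q - 1 / r') * r' = (r' - q) / q"
      using qr q by (simp add: field_simps)
    ultimately have R: "R \<le> \<gamma> powr ((r' - q) / q) * lam powr r'"
      using qr by (simp add: powr_mult powr_powr R_def sum_nonneg)
    \<comment> \<open>Splitting at height u replaces Hoelder's inequality.\<close>
    have "a Q powr q \<le> u powr q + a Q powr r' * u powr (q - r')" if "Q \<in> F" for Q
    proof (cases "a Q \<le> u")
      case True
      have "a Q powr q \<le> u powr q"
        using True pos that F q by (intro powr_mono2) (auto intro: less_imp_le)
      then show ?thesis by (simp add: add_increasing2)
    next
      case False
      have a0: "0 < a Q" using pos that F by auto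
      have "a Q powr (q - r') \<le> u powr (q - r')"
        using False u0 qr by (intro powr_mono2') auto
      then have "a Q powr r' * a Q powr (q - r') \<le> a Q powr r' * u powr (q - r')"
        by (intro mult_left_mono) auto
      then show ?thesis using a0 by (simp add: powr_add[symmetric] add_increasing)
    qed
    then have "(\<Sum>Q\<in>F. a Q powr q) \<le> (\<Sum>Q\<in>F. u powr q + a Q powr r' * u powr (q - r'))"
      by (rule sum_mono)
    also have "\<dots> = real (card F) * u powr q + R * u powr (q - r')"
      by (simp add: sum.distrib R_def sum_distrib_right)
    also have "R * u powr (q - r') \<le> (\<gamma> powr ((r' - q) / q) * lam powr r') * u powr (q - r')"
      by (intro mult_right_mono R) auto
    also have "\<dots> = (D / 2) * lam powr q"
    proof -
      have "u powr (q - r') = lam powr (q - r') * \<gamma> powr ((q - r') / q) * (D / 2) powr 1"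
      proof -
        have "- 1 / (r' - q) * (q - r') = 1" using qr by (simp add: divide_simps)
        then show ?thesis
          using lam g D unfolding u_def by (simp only: powr_mult powr_powr) simp
      qed
      moreover have "\<gamma> powr ((r' - q) / q) * \<gamma> powr ((q - r') / q) = 1"
        using g by (simp add: powr_add[symmetric] add_divide_distrib[symmetric])
      moreover have "lam powr r' * lam powr (q - r') = lam powr q"
        using lam by (simp add: powr_add[symmetric])
      moreover have "(D / 2) powr 1 = D / 2" using D by simp
      ultimately show ?thesis by algebra
    qed
    finally have "(D / 2) * lam powr q < real (card F) * u powr q" using low by simp
    also have "u powr q = lam powr q * \<gamma> * (D / 2) powr (- q / (r' - q))"
      using lam g D q unfolding u_def by (simp add: powr_mult powr_powr)
    finally have "D / 2 < real (card F) * \<gamma> * (D / 2) powr (- q / (r' - q))" using lam by (simp add: ac_simps)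
    then have "(D / 2) * (D / 2) powr (q / (r' - q))
        \<le> real (card F) * \<gamma> * (D / 2) powr (- q / (r' - q)) * (D / 2) powr (q / (r' - q))"
      by (intro mult_right_mono) auto
    also have "\<dots> = real (card F) * \<gamma>" using D by (simp add: mult.assoc powr_add[symmetric])
    finally show "c / \<gamma> \<le> real (card F)" using g by (simp add: c_def field_simps)
  qed
qed

subsection \<open>The threefold finer grid\<close>

text \<open>The fibres at level \<open>i\<close> are the half-open cells of side
  \<open>2 powr (-i) / 3\<close> of a grid with a vertex at the origin, independent of the shift of
  the dyadic grid.\<close>

definition fine_index :: "int \<Rightarrow> real^'n::finite \<Rightarrow> 'n \<Rightarrow> int" where
  "fine_index i x = (\<lambda>c. \<lfloor>3 * 2 powr i * x $ c\<rfloor>)"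

text \<open>The arbitrary unions of level \<open>i\<close> cells. As there are countably many cells,
  this is the sigma-algebra they generate, the filtration of the stopping argument.\<close>

definition saturated :: "int \<Rightarrow> (real^'n::finite) set set" where
  "saturated i = {A. \<forall>x\<in>A. \<forall>y. fine_index i x = fine_index i y \<longrightarrow> y \<in> A}"

lemma fine_index_mono:
  assumes ij: "i \<le> j" and eq: "fine_index j x = fine_index j y"
  shows "fine_index i x = fine_index i y"
proof
  fix c
  obtain n where n: "j = i + int n" using ij zle_iff_zadd by blast
  \<comment> \<open>The coarser index is the finer one divided by a power of 2 and rounded down,
    hence a function of it.\<close>
  have *: "fine_index i z c = fine_index j z c div 2 ^ n" for z :: "real^'a"
  proof -
    have "3 * 2 powr i * z $ c = (3 * 2 powr j * z $ c) / real_of_int (2 ^ n)"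
      by (simp add: n powr_add powr_realpow)
    then show ?thesis
      unfolding fine_index_def by (metis floor_divide_real_eq_div zero_le_numeral zero_le_power)
  qed
  show "fine_index i x c = fine_index i y c" by (simp add: * eq)
qed

lemma saturated_iff:
  "A \<in> saturated i \<Longrightarrow> fine_index i x = fine_index i y \<Longrightarrow> x \<in> A \<longleftrightarrow> y \<in> A"
  unfolding saturated_def mem_Collect_eq by fastforce

lemma saturated_mono: "i \<le> j \<Longrightarrow> saturated i \<subseteq> saturated j"
  using fine_index_mono unfolding saturated_def by blast

lemma fine_cell_eq_cube:
  "{x. fine_index i x = k} = cube (\<chi> c. k c / (3 * 2 powr i)) (1 / (3 * 2 powr i))"
  by (auto simp: fine_index_def cube_def fun_eq_iff floor_eq_iff field_simps add_divide_distrib[symmetric])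

lemma saturated_decompose:
  "A \<in> saturated i \<Longrightarrow> A = (\<Union>k\<in>fine_index i ` A. {x. fine_index i x = k})"
  unfolding saturated_def by (auto; metis)

lemma sets_saturated:
  fixes A :: "(real^'n::finite) set"
  assumes "A \<in> saturated i"
  shows "A \<in> sets lebesgue"
proof -
  have "(\<Union>k\<in>fine_index i ` A. {x. fine_index i x = k}) \<in> sets lebesgue"
    by (rule sets.countable_UN'') (auto simp: fine_cell_eq_cube sets_cube)
  then show ?thesis using saturated_decompose[OF assms] by simp
qed

lemma dyadic_cube_eq_cube:
  "dyadic_cube \<alpha> j k = cube (\<chi> c. 2 powr (- real_of_int j) * (\<alpha> c + k c)) (2 powr (- real_of_int j))"
  by (auto simp: dyadic_cube_def cube_def algebra_simps)

text \<open>The grids with a fixed shift are not nested across consecutive scales, but since the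
  shifts are multiples of 1/3 every cube is a union of cells of a threefold finer nested grid.\<close>
lemma dyadic_cube_saturated:
  assumes "grid_shift \<alpha>"
  shows "dyadic_cube \<alpha> j k \<in> saturated j"
proof -
  \<comment> \<open>After scaling by \<open>3 * 2 powr j\<close> the faces of the cube have integer
    coordinates, so the inequalities for \<open>x\<close> pass to its floor.\<close>
  have *: "x \<in> dyadic_cube \<alpha> j k \<longleftrightarrow>
      (\<forall>c. \<lfloor>3 * \<alpha> c\<rfloor> + 3 * k c \<le> fine_index j x c \<and> fine_index j x c < \<lfloor>3 * \<alpha> c\<rfloor> + 3 * k c + 3)" for x
  proof -
    have "(2 powr (- real_of_int j) * (\<alpha> c + k c) \<le> x $ c \<and> x $ c < 2 powr (- real_of_int j) * (\<alpha> c + k c + 1))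
      \<longleftrightarrow> (\<lfloor>3 * \<alpha> c\<rfloor> + 3 * k c \<le> fine_index j x c \<and> fine_index j x c < \<lfloor>3 * \<alpha> c\<rfloor> + 3 * k c + 3)" for c
    proof -
      have a: "3 * \<alpha> c = \<lfloor>3 * \<alpha> c\<rfloor>"
      proof -
        have "\<alpha> c \<in> {0, 1/3, 2/3}" using assms by (simp add: grid_shift_def)
        then have "3 * \<alpha> c = of_int 0 \<or> 3 * \<alpha> c = of_int 1 \<or> 3 * \<alpha> c = of_int 2" by auto
        then show ?thesis by (metis floor_of_int)
      qed
      let ?m = "\<lfloor>3 * \<alpha> c\<rfloor> + 3 * k c"
      define t where "t = 2 powr j * x $ c"
      have t: "3 * 2 powr j * x $ c = 3 * t" by (simp add: t_def)
      have m: "real_of_int ?m = 3 * \<alpha> c + 3 * real_of_int (k c)" using a by simp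
      have "(2 powr (- real_of_int j) * (\<alpha> c + k c) \<le> x $ c) \<longleftrightarrow> real_of_int ?m \<le> 3 * 2 powr j * x $ c"
      proof -
        have "2 powr (- real_of_int j) * (\<alpha> c + k c) \<le> x $ c \<longleftrightarrow> \<alpha> c + real_of_int (k c) \<le> t"
          by (simp add: t_def powr_minus field_simps)
        moreover have "real_of_int ?m = 3 * \<alpha> c + 3 * real_of_int (k c)" using m by simp
        ultimately show ?thesis unfolding t by argo
      qed
      moreover have "(x $ c < 2 powr (- real_of_int j) * (\<alpha> c + k c + 1)) \<longleftrightarrow> 3 * 2 powr j * x $ c < real_of_int (?m + 3)"
      proof -
        have "x $ c < 2 powr (- real_of_int j) * (\<alpha> c + k c + 1) \<longleftrightarrow> t < \<alpha> c + k c + 1"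
          by (simp add: t_def powr_minus field_simps)
        moreover have "real_of_int (?m + 3) = 3 * \<alpha> c + 3 * real_of_int (k c) + 3" using m by simp
        ultimately show ?thesis unfolding t by argo
      qed
      ultimately show ?thesis unfolding fine_index_def by (simp only: le_floor_iff floor_less_iff)
    qed
    then show ?thesis by (simp add: dyadic_cube_def)
  qed
  show ?thesis
    unfolding saturated_def mem_Collect_eq
  proof (intro ballI allI impI)
    fix x y assume "x \<in> dyadic_cube \<alpha> j k" "fine_index j x = fine_index j y"
    then show "y \<in> dyadic_cube \<alpha> j k" using *[of x] *[of y] by simp
  qed
qed

text \<open>It makes counting levels the same as counting cubes: at each level at most one cube
  contains a given point.\<close>

lemma dyadic_cube_unique:
  assumes "x \<in> dyadic_cube \<alpha> j k" "x \<in> dyadic_cube \<alpha> j k'"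
  shows "k = k'"
proof
  fix c
  have *: "\<alpha> c + k c \<le> 2 powr j * x $ c \<and> 2 powr j * x $ c < \<alpha> c + k c + 1" if "x \<in> dyadic_cube \<alpha> j k" for k
    using that by (auto simp: dyadic_cube_def powr_minus field_simps dest!: spec[of _ c])
  show "k c = k' c" using *[OF assms(1)] *[OF assms(2)] by linarith
qed

section \<open>The Carleson condition on unions of cells\<close>

text \<open>Both sides are countably additive over the cells that make up \<open>A\<close>, so it
  suffices to apply \<open>carleson_cube\<close> to each cell.\<close>

lemma carleson_saturated:
  fixes w :: "real^'n::finite \<Rightarrow> real"
  assumes w: "is_weight w" and fin: "finite S" and eta: "0 < \<eta>" and sp: "sparse \<eta> S"
    and lev: "\<And>Q. Q \<in> S \<Longrightarrow> \<exists>k. Q = dyadic_cube \<alpha> (lev Q) k"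
    and A: "A \<in> saturated i"
  defines "M \<equiv> density lebesgue (\<lambda>x. ennreal (w x))"
  shows "ennreal \<eta> * (\<Sum>Q\<in>{Q\<in>S. i \<le> lev Q}. emeasure M (A \<inter> Q))
    \<le> 14 ^ CARD('n) * (FW_const w * emeasure M A)"
proof -
  let ?S = "{Q\<in>S. i \<le> lev Q}"
  let ?C = "\<lambda>k. {x. fine_index i x = k}"
  let ?I = "fine_index i ` A"
  have [measurable]: "w \<in> borel_measurable lebesgue" using w by (simp add: is_weight_def)
  have M: "emeasure M B = wmeas w B" if "B \<in> sets lebesgue" for B
    using that unfolding M_def wmeas_def by (subst emeasure_density) auto
  have sM: "sets M = sets lebesgue" by (simp add: M_def)
  have "\<forall>Q\<in>S. \<exists>k. Q = dyadic_cube \<alpha> (lev Q) k" using lev by blast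
  from bchoice[OF this] obtain p where "\<forall>Q\<in>S. Q = dyadic_cube \<alpha> (lev Q) (p Q)" ..
  note p = this[rule_format]
  from sp obtain E where E: "\<forall>Q\<in>S. E Q \<subseteq> Q \<and> E Q \<in> sets lebesgue \<and> \<eta> * measure lebesgue Q \<le> measure lebesgue (E Q)"
    and disj: "\<forall>Q\<in>S. \<forall>Q'\<in>S. Q \<noteq> Q' \<longrightarrow> E Q \<inter> E Q' = {}"
    unfolding sparse_def by (elim exE conjE)
  have Qs: "Q \<in> sets lebesgue" if "Q \<in> S" for Q
    by (subst p[OF that]) (simp add: dyadic_cube_eq_cube sets_cube)
  have Cs: "?C k \<in> sets lebesgue" for k by (simp add: fine_cell_eq_cube sets_cube)
  \<comment> \<open>The countable sum over cells is an integral against counting measure, which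
    gives linearity and monotonicity without summability conditions.\<close>
  have split: "emeasure M (A \<inter> B) = (\<integral>\<^sup>+k. emeasure M (?C k \<inter> B) \<partial>count_space ?I)" if "B \<in> sets lebesgue" for B
  proof -
    have "A \<inter> B = (\<Union>k\<in>?I. ?C k \<inter> B)" using saturated_decompose[OF A] by blast
    also have "emeasure M \<dots> = (\<integral>\<^sup>+k. emeasure M (?C k \<inter> B) \<partial>count_space ?I)"
      using that Cs by (intro emeasure_UN_countable) (auto simp: sM disjoint_family_on_def)
    finally show ?thesis .
  qed
  have cell: "ennreal \<eta> * (\<Sum>Q\<in>?S. emeasure M (?C k \<inter> Q)) \<le> 14 ^ CARD('n) * (FW_const w * emeasure M (?C k))" for k
  proof -
    let ?s = "1 / (3 * 2 powr i) :: real"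
    let ?c = "\<chi> c. k c / (3 * 2 powr i)"
    have "ennreal \<eta> * (\<Sum>Q\<in>?S. wmeas w (Q \<inter> cube ?c ?s)) \<le> 14 ^ CARD('n) * (FW_const w * wmeas w (cube ?c ?s))"
    proof (rule carleson_cube[where E = E, OF w _ _ eta])
      fix Q assume Q: "Q \<in> ?S"
      \<comment> \<open>A cube of level at least \<open>i\<close> has side at most three times that
        of a level \<open>i\<close> cell, the limit allowed by \<open>carleson_cube\<close>.\<close>
      have "2 powr (- real_of_int (lev Q)) \<le> 2 powr (- real_of_int i)" using Q by simp
      then show "0 < 2 powr (- real_of_int (lev Q)) \<and> 2 powr (- real_of_int (lev Q)) \<le> 3 * ?s \<and>
          Q = cube (\<chi> c. 2 powr (- real_of_int (lev Q)) * (\<alpha> c + p Q c)) (2 powr (- real_of_int (lev Q)))"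
        using p[of Q] Q by (simp add: dyadic_cube_eq_cube powr_minus divide_simps)
    qed (use fin E disj in auto)
    moreover have "emeasure M (?C k \<inter> Q) = wmeas w (Q \<inter> cube ?c ?s)" if "Q \<in> ?S" for Q
      using M[of "?C k \<inter> Q"] Cs[of k] Qs[of Q] that unfolding fine_cell_eq_cube by (simp add: Int_commute)
    moreover have "emeasure M (?C k) = wmeas w (cube ?c ?s)"
      using M[OF Cs[of k]] unfolding fine_cell_eq_cube .
    ultimately show ?thesis by simp
  qed
  have "ennreal \<eta> * (\<Sum>Q\<in>?S. emeasure M (A \<inter> Q)) = ennreal \<eta> * (\<Sum>Q\<in>?S. \<integral>\<^sup>+k. emeasure M (?C k \<inter> Q) \<partial>count_space ?I)"
    by (intro arg_cong2[where f = "(*)"] refl sum.cong split) (use Qs in auto)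
  also have "\<dots> = (\<integral>\<^sup>+k. ennreal \<eta> * (\<Sum>Q\<in>?S. emeasure M (?C k \<inter> Q)) \<partial>count_space ?I)"
    by (simp add: nn_integral_sum nn_integral_cmult)
  also have "\<dots> \<le> (\<integral>\<^sup>+k. 14 ^ CARD('n) * (FW_const w * emeasure M (?C k)) \<partial>count_space ?I)"
    by (intro nn_integral_mono cell)
  also have "\<dots> = 14 ^ CARD('n) * (FW_const w * (\<integral>\<^sup>+k. emeasure M (?C k \<inter> UNIV) \<partial>count_space ?I))"
    by (simp add: nn_integral_cmult)
  also have "\<dots> = 14 ^ CARD('n) * (FW_const w * emeasure M A)"
    by (subst split[symmetric]) auto
  finally show ?thesis .
qed

subsection \<open>The stopping argument\<close>

text \<open>The hypothesis of \<open>exponential_moment\<close> with one set per level: the cubes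
  are grouped by level, and \<open>\<eta>\<close> is divided out to give the constant
  \<open>L\<close>.\<close>

lemma carleson_levels:
  fixes w :: "real^'n::finite \<Rightarrow> real"
  assumes w: "is_weight w" and FW: "FW_const w = ennreal W" "1 \<le> W"
    and fin: "finite S" and eta: "0 < \<eta>" and sp: "sparse \<eta> S"
    and lev: "\<And>Q. Q \<in> S \<Longrightarrow> \<exists>k. Q = dyadic_cube \<alpha> (lev Q) k"
    and A: "A \<in> saturated i"
  defines "M \<equiv> density lebesgue (\<lambda>x. ennreal (w x))"
  shows "(\<Sum>j\<in>{j\<in>lev ` S. i \<le> j}. emeasure M (A \<inter> \<Union>{Q\<in>S. lev Q = j}))
    \<le> ennreal (14 ^ CARD('n) * W / \<eta>) * emeasure M A"
proof -
  have sM: "sets M = sets lebesgue" by (simp add: M_def)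
  have Qs: "Q \<in> sets lebesgue" if "Q \<in> S" for Q
    using lev[OF that] by (metis dyadic_cube_eq_cube sets_cube)
  have As: "A \<in> sets lebesgue" by (rule sets_saturated[OF A])
  let ?X = "\<Sum>Q\<in>{Q\<in>S. i \<le> lev Q}. emeasure M (A \<inter> Q)"
  have "(\<Sum>j\<in>{j\<in>lev ` S. i \<le> j}. emeasure M (A \<inter> \<Union>{Q\<in>S. lev Q = j}))
      \<le> (\<Sum>j\<in>{j\<in>lev ` S. i \<le> j}. \<Sum>Q\<in>{Q\<in>{Q\<in>S. i \<le> lev Q}. lev Q = j}. emeasure M (A \<inter> Q))"
  proof (intro sum_mono)
    fix j assume "j \<in> {j\<in>lev ` S. i \<le> j}"
    then have eq: "{Q\<in>{Q\<in>S. i \<le> lev Q}. lev Q = j} = {Q\<in>S. lev Q = j}" by auto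
    have "A \<inter> \<Union>{Q\<in>S. lev Q = j} = (\<Union>Q\<in>{Q\<in>S. lev Q = j}. A \<inter> Q)" by auto
    also have "emeasure M \<dots> \<le> (\<Sum>Q\<in>{Q\<in>S. lev Q = j}. emeasure M (A \<inter> Q))"
      using fin As Qs by (intro emeasure_subadditive_finite) (auto simp: sM)
    finally show "emeasure M (A \<inter> \<Union>{Q\<in>S. lev Q = j})
        \<le> (\<Sum>Q\<in>{Q\<in>{Q\<in>S. i \<le> lev Q}. lev Q = j}. emeasure M (A \<inter> Q))"
      unfolding eq .
  qed
  also have "\<dots> = ?X"
    using fin by (intro sum.group) auto
  also have "\<dots> = ennreal (1 / \<eta>) * (ennreal \<eta> * ?X)"
    using eta by (simp add: mult.assoc[symmetric] ennreal_mult[symmetric])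
  also have "\<dots> \<le> ennreal (1 / \<eta>) * (14 ^ CARD('n) * (FW_const w * emeasure M A))"
    using carleson_saturated[OF w fin eta sp lev A] unfolding M_def by (intro mult_left_mono) auto
  also have "\<dots> = ennreal (1 / \<eta>) * ennreal (14 ^ CARD('n)) * ennreal W * emeasure M A"
    using FW by (simp add: mult.assoc ennreal_power[symmetric])
  also have "ennreal (1 / \<eta>) * ennreal (14 ^ CARD('n)) * ennreal W = ennreal (14 ^ CARD('n) * W / \<eta>)"
    using eta FW(2) by (simp add: ennreal_mult[symmetric])
  finally show ?thesis .
qed

section \<open>Exponential tails for the number of levels\<close>

lemma borel_measurable_card_filter:
  assumes "finite J" and "\<And>j. j \<in> J \<Longrightarrow> U j \<in> sets M"
  shows "(\<lambda>x. real (card {j\<in>J. x \<in> U j})) \<in> borel_measurable M"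
proof -
  have "real (card {j\<in>J. x \<in> U j}) = (\<Sum>j\<in>J. indicator (U j) x)" for x
    using assms(1) by (simp add: indicator_def sum.If_cases Int_def)
  then show ?thesis using assms(2) by simp
qed

lemma level_union_saturated:
  assumes "grid_shift \<alpha>" and "\<And>Q. Q \<in> S \<Longrightarrow> \<exists>k. Q = dyadic_cube \<alpha> (lev Q) k"
  shows "\<Union>{Q\<in>S. lev Q = j} \<in> saturated j"
proof -
  have "Q \<in> saturated j" if "Q \<in> S" "lev Q = j" for Q
    using assms(2)[OF that(1)] dyadic_cube_saturated[OF assms(1)] that(2) by metis
  then show ?thesis unfolding saturated_def by blast
qed

lemma borel_measurable_level_count:
  fixes S :: "(real^'n::finite) set set"
  assumes "grid_shift \<alpha>" and "finite S"
    and "\<And>Q. Q \<in> S \<Longrightarrow> \<exists>k. Q = dyadic_cube \<alpha> (lev Q) k"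
  shows "(\<lambda>x. real (card {j\<in>lev ` S. i \<le> j \<and> x \<in> \<Union>{Q\<in>S. lev Q = j}})) \<in> borel_measurable lebesgue"
  using borel_measurable_card_filter[of "{j\<in>lev ` S. i \<le> j}" "\<lambda>j. \<Union>{Q\<in>S. lev Q = j}" lebesgue]
    assms(2) sets_saturated[OF level_union_saturated[OF assms(1,3)]]
  by (simp only: mem_Collect_eq conj_assoc) simp

text \<open>Markov's inequality for \<open>(1 + e) ^ N x\<close>, whose integral over
  \<open>A\<close> is controlled by \<open>exponential_moment\<close>; the factor 2 is the one from
  that bound.\<close>

lemma counting_tail:
  fixes w :: "real^'n::finite \<Rightarrow> real"
  assumes w: "is_weight w" and FW: "FW_const w = ennreal W" "1 \<le> W"
    and \<alpha>: "grid_shift \<alpha>"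
    and fin: "finite S" and eta: "0 < \<eta>" "\<eta> < 1" and sp: "sparse \<eta> S"
    and lev: "\<And>Q. Q \<in> S \<Longrightarrow> \<exists>k. Q = dyadic_cube \<alpha> (lev Q) k"
    and A: "A \<in> saturated i"
  defines "N \<equiv> (\<lambda>x. card {j\<in>lev ` S. i \<le> j \<and> x \<in> \<Union>{Q\<in>S. lev Q = j}})"
  assumes t: "0 \<le> t"
  shows "wmeas w {x\<in>A. t \<le> real (N x)}
    \<le> ennreal (2 * exp (- (t * \<eta> / (4 * 14 ^ CARD('n) * W)))) * wmeas w A"
proof -
  define M where "M = density lebesgue (\<lambda>x. ennreal (w x))"
  define L where "L = 14 ^ CARD('n) * W / \<eta>"
  have wm [measurable]: "w \<in> borel_measurable lebesgue" using w by (simp add: is_weight_def)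
  have L1: "1 \<le> L"
  proof -
    have "\<eta> \<le> 1 * 1" using eta by simp
    also have "\<dots> \<le> 14 ^ CARD('n) * W" using FW(2) by (intro mult_mono) auto
    finally show ?thesis using eta by (simp add: L_def)
  qed
  \<comment> \<open>The largest value allowed by \<open>2 * (e * L) \<le> 1\<close>. Since
    \<open>L\<close> is at least 1, it is at most \<open>1 / 2\<close>, which the logarithm estimate
    below uses.\<close>
  define e where "e = 1 / (2 * L)"
  have e: "0 < e" "e \<le> 1" using L1 by (auto simp: e_def divide_simps)
  have As: "A \<in> sets lebesgue" by (rule sets_saturated[OF A])
  have MA: "emeasure M A = wmeas w A"
    using As unfolding M_def wmeas_def by (subst emeasure_density) auto
  have Usat: "\<Union>{Q\<in>S. lev Q = j} \<in> saturated j" for j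
    by (rule level_union_saturated[OF \<alpha> lev])
  have [measurable]: "A \<in> sets lebesgue" by (rule As)
  have [measurable]: "(\<lambda>x. real (N x)) \<in> borel_measurable lebesgue"
    unfolding N_def by (rule borel_measurable_level_count[OF \<alpha> fin lev])
  have "(\<lambda>x. (1 + e) powr real (N x)) \<in> borel_measurable lebesgue"
    by measurable
  then have [measurable]: "(\<lambda>x. (1 + e) ^ N x) \<in> borel_measurable lebesgue"
    using e by (simp add: powr_realpow)
  have "(\<integral>\<^sup>+x\<in>A. (1 + ennreal e) ^ N x \<partial>M) \<le> 2 * emeasure M A"
    unfolding N_def
  proof (rule exponential_moment[where \<A> = saturated and L = "ennreal L"])
    show "2 * (ennreal e * ennreal L) \<le> 1"
    proof -
      have "ennreal e * ennreal L = ennreal (1 / 2)"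
        using e L1 by (subst ennreal_mult[symmetric]) (auto simp: e_def)
      moreover have "2 * ennreal (1 / 2) = ennreal (2 * (1 / 2))"
        by (subst ennreal_mult) auto
      ultimately show ?thesis by simp
    qed
    show "(\<Sum>j\<in>{j \<in> lev ` S. i' \<le> j}. emeasure M (B \<inter> \<Union>{Q\<in>S. lev Q = j})) \<le> ennreal L * emeasure M B"
      if "B \<in> saturated i'" for i' B
      unfolding M_def L_def by (rule carleson_levels[OF w FW fin eta(1) sp lev that])
    show "B \<in> sets M" if "B \<in> saturated i'" for i' B
      using sets_saturated[OF that] by (simp add: M_def)
    show "B \<inter> B' \<in> saturated i'" if "B \<in> saturated i'" "B' \<in> saturated i'" for i' B B'
      using that unfolding saturated_def by blast
  qed (use fin A Usat saturated_mono in auto)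
  then have mom: "(\<integral>\<^sup>+x\<in>A. ennreal ((1 + e) ^ N x) \<partial>M) \<le> 2 * wmeas w A"
    using e by (simp add: MA ennreal_power[symmetric] ennreal_plus)
  have "wmeas w {x\<in>A. t \<le> real (N x)}
      \<le> (\<integral>\<^sup>+x\<in>A. ennreal ((1 + e) powr (- t)) * ennreal ((1 + e) ^ N x) \<partial>M)"
  proof -
    have "ennreal (w x) * indicator {x\<in>A. t \<le> real (N x)} x
        \<le> ennreal (w x) * (ennreal ((1 + e) powr (- t)) * ennreal ((1 + e) ^ N x) * indicator A x)" for x
    proof (cases "x \<in> A \<and> t \<le> real (N x)")
      case True
      have "1 \<le> (1 + e) powr (real (N x) - t)" using True e by (simp add: ge_one_powr_ge_zero)
      also have "\<dots> = (1 + e) powr (- t) * (1 + e) ^ N x"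
        using e by (simp add: powr_realpow[symmetric] powr_add[symmetric])
      finally have "1 \<le> ennreal ((1 + e) powr (- t)) * ennreal ((1 + e) ^ N x)"
        using e by (simp add: ennreal_mult[symmetric] ennreal_leI flip: ennreal_1)
      then show ?thesis
        using True mult_left_mono[of 1 _ "ennreal (w x)"] by simp
    qed auto
    moreover have "(\<lambda>x. ennreal ((1 + e) powr (- t)) * ennreal ((1 + e) ^ N x) * indicator A x) \<in> borel_measurable lebesgue"
      by measurable
    ultimately show ?thesis
      unfolding wmeas_def M_def by (subst nn_integral_density) (auto intro!: nn_integral_mono)
  qed
  also have "\<dots> = ennreal ((1 + e) powr (- t)) * (\<integral>\<^sup>+x\<in>A. ennreal ((1 + e) ^ N x) \<partial>M)"
    by (subst nn_integral_cmult[symmetric]) (auto simp: M_def mult.assoc)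
  also have "\<dots> \<le> ennreal ((1 + e) powr (- t)) * (2 * wmeas w A)"
    by (intro mult_left_mono mom) auto
  also have "\<dots> = ennreal (2 * (1 + e) powr (- t)) * wmeas w A"
    by (simp add: ennreal_mult ac_simps)
  also have "\<dots> \<le> ennreal (2 * exp (- (t * \<eta> / (4 * 14 ^ CARD('n) * W)))) * wmeas w A"
  proof (intro mult_right_mono ennreal_leI mult_left_mono)
    \<comment> \<open>This turns powers of \<open>1 + e\<close> into exponentials;
      \<open>e / 2\<close> equals \<open>\<eta> / (4 * 14 ^ CARD('n) * W)\<close>, the rate in the
      conclusion.\<close>
    have "e / 2 \<le> ln (1 + e)"
    proof -
      have "e - e\<^sup>2 \<le> ln (1 + e)" using e by (intro ln_one_plus_pos_lower_bound) auto
      have "e \<le> 1 / 2" using L1 by (simp add: e_def divide_simps)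
      then have "e\<^sup>2 \<le> e / 2" using e by (simp add: power2_eq_square)
      with \<open>e - e\<^sup>2 \<le> ln (1 + e)\<close> show ?thesis by simp
    qed
    then have "t * (e / 2) \<le> t * ln (1 + e)" using t by (rule mult_left_mono)
    moreover have "t * (e / 2) = t * \<eta> / (4 * 14 ^ CARD('n) * W)"
      using eta FW(2) by (simp add: e_def L_def)
    ultimately have "t * \<eta> / (4 * 14 ^ CARD('n) * W) \<le> t * ln (1 + e)" by linarith
    moreover have "(1 + e) powr (- t) = exp (- (t * ln (1 + e)))" using e by (simp add: powr_def)
    ultimately show "(1 + e) powr (- t) \<le> exp (- (t * \<eta> / (4 * 14 ^ CARD('n) * W)))"
      by (simp only: exp_le_cancel_iff neg_le_iff_le)
  qed auto
  finally show ?thesis .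
qed

section \<open>Stopping sets and the good-lambda inequality\<close>

theorem theorem4p2:
  fixes q r :: ereal
  assumes "0 < q" and "q < r"
  shows "\<exists>\<delta>>0. \<exists>C>0. \<forall>(\<alpha>::'n::finite \<Rightarrow> real) w \<eta> S a lam \<gamma>.
           grid_shift \<alpha> \<and> A_FW w \<and> 0 < \<eta> \<and> \<eta> < 1 \<and>
           S \<subseteq> dyadic_grid \<alpha> \<and> finite S \<and> sparse \<eta> S \<and>
           (\<forall>Q\<in>S. 0 < a Q) \<and> 0 < lam \<and> 0 < \<gamma> \<longrightarrow>
           wmeas w {x. 2 * lam < sparse_op q S a x \<and>
                       sparse_op r S a x \<le> \<gamma> powr (inv_exp q - inv_exp r) * lam}
           \<le> ennreal (C * exp (- \<delta> * \<eta> / (\<gamma> * enn2real (FW_const w))))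
              * wmeas w {x. lam < sparse_op q S a x}"
proof -
  \<comment> \<open>The strict inequality \<open>q < r\<close> makes \<open>q\<close>
    finite.\<close>
  obtain p where p: "q = ereal p" "0 < p"
    using assms by (cases q) auto
  \<comment> \<open>\<open>D * lam powr p\<close> is the gap between \<open>(2 * lam) powr p\<close>
    and \<open>lam powr p\<close>, which the cubes from the stopping scale on must supply.\<close>
  define D where "D = 2 powr p - 1"
  have D: "0 < D" using p by (simp add: D_def)
  obtain c where c: "0 < c" and count: "\<And>S (a :: (real^'n) set \<Rightarrow> real) x F lam \<gamma>.
    finite S \<Longrightarrow> (\<forall>Q\<in>S. 0 < a Q) \<Longrightarrow> F \<subseteq> {Q\<in>S. x \<in> Q} \<Longrightarrow> 0 < lam \<Longrightarrow> 0 < \<gamma> \<Longrightarrow>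
    sparse_op r S a x \<le> \<gamma> powr (1 / p - inv_exp r) * lam \<Longrightarrow>
    D * lam powr p < (\<Sum>Q\<in>F. a Q powr p) \<Longrightarrow> c / \<gamma> \<le> real (card F)"
    using card_lower_bound[of p r D] assms(2) p D by blast
  \<comment> \<open>The witness for \<open>\<delta>\<close> combines \<open>c\<close> from the count
    with the rate in \<open>counting_tail\<close>; \<open>C\<close> is the factor 2 there.\<close>
  show ?thesis
  proof (rule exI[of _ "c / (4 * 14 ^ CARD('n))"], rule conjI[rotated],
      rule exI[of _ 2], rule conjI[rotated], intro allI impI, elim conjE)
    fix \<alpha> :: "'n \<Rightarrow> real" and w :: "real^'n \<Rightarrow> real" and \<eta> :: real and S :: "(real^'n) set set" and a :: "(real^'n) set \<Rightarrow> real" and lam \<gamma> :: real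
    assume \<alpha>: "grid_shift \<alpha>" and A: "A_FW w" and eta: "0 < \<eta>" "\<eta> < 1"
      and S: "S \<subseteq> dyadic_grid \<alpha>" and fin: "finite S" and sp: "sparse \<eta> S"
      and a: "\<forall>Q\<in>S. 0 < a Q" and lam: "0 < lam" and g: "0 < \<gamma>"
    have w: "is_weight w" using A by (simp add: A_FW_def)
    define W where "W = enn2real (FW_const w)"
    have FW: "FW_const w = ennreal W" using A by (simp add: A_FW_def W_def)
    have W1: "1 \<le> W" using FW_const_ge_1[OF w] unfolding FW
      by (metis ennreal_1 ennreal_le_iff2 not_one_le_zero zero_le_one)
    have "\<forall>Q\<in>S. \<exists>j. \<exists>k. Q = dyadic_cube \<alpha> j k" using S by (auto simp: dyadic_grid_def)
    from bchoice[OF this] obtain lev where lev: "\<And>Q. Q \<in> S \<Longrightarrow> \<exists>k. Q = dyadic_cube \<alpha> (lev Q) k" by blast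
    have lev_inj: "Q = Q'" if "Q \<in> S" "Q' \<in> S" "lev Q = lev Q'" "x \<in> Q" "x \<in> Q'" for Q Q' x
      using lev[OF that(1)] lev[OF that(2)] that dyadic_cube_unique by metis
    have [measurable]: "w \<in> borel_measurable lebesgue" using w by (simp add: is_weight_def)
    define M where "M = density lebesgue (\<lambda>x. ennreal (w x))"
    have M: "emeasure M B = wmeas w B" if "B \<in> sets lebesgue" for B
      using that unfolding M_def wmeas_def by (subst emeasure_density) auto
    \<comment> \<open>The predicate \<open>P\<close> selects levels, so that partial sums from
      coarse to fine scales and their tails are instances of one function.\<close>
    define G where "G = (\<lambda>P (x::real^'n). \<Sum>Q\<in>{Q\<in>S. x \<in> Q \<and> P (lev Q)}. a Q powr p)"
    have op: "sparse_op q S a x = G (\<lambda>_. True) x powr (1 / p)" for x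
    proof -
      have "(\<Sum>Q\<in>S. a Q powr p * indicator Q x) = (\<Sum>Q\<in>S. if x \<in> Q then a Q powr p else 0)"
        by (intro sum.cong) auto
      also have "\<dots> = G (\<lambda>_. True) x"
        unfolding G_def using fin by (simp add: sum.inter_filter)
      finally show ?thesis using p by (simp add: sparse_op_def)
    qed
    have G0: "0 \<le> G P x" for P x unfolding G_def by (intro sum_nonneg) auto
    have op_less: "t < sparse_op q S a x \<longleftrightarrow> t powr p < G (\<lambda>_. True) x" if "0 < t" for t x
    proof -
      have y: "(G (\<lambda>_. True) x powr (1 / p)) powr p = G (\<lambda>_. True) x"
        using p G0 by (simp add: powr_powr)
      show ?thesis
      proof
        assume "t < sparse_op q S a x"
        then show "t powr p < G (\<lambda>_. True) x"
          using powr_less_mono2[of p t "G (\<lambda>_. True) x powr (1 / p)"] that p y unfolding op by simp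
      next
        assume "t powr p < G (\<lambda>_. True) x"
        then show "t < sparse_op q S a x"
          using powr_mono2[of p "G (\<lambda>_. True) x powr (1 / p)" t] p y unfolding op by fastforce
      qed
    qed
    \<comment> \<open>The points at which the coarse-to-fine partial sum first exceeds
      \<open>lam powr p\<close> at level \<open>i\<close>; larger levels are finer.\<close>
    define Om where "Om = (\<lambda>i. {x. G (\<lambda>j. j < i) x \<le> lam powr p \<and> lam powr p < G (\<lambda>j. j \<le> i) x})"
    define T where "T = {x. 2 * lam < sparse_op q S a x \<and>
                       sparse_op r S a x \<le> \<gamma> powr (inv_exp q - inv_exp r) * lam}"
    let ?J = "lev ` S"
    have G_split: "G P x = G (\<lambda>j. P j \<and> R j) x + G (\<lambda>j. P j \<and> \<not> R j) x" for P R x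
      unfolding G_def using fin
      by (subst sum.union_disjoint[symmetric]) (auto intro!: sum.cong)
    have G_mono: "G P x \<le> G R x" if "\<And>j. P j \<Longrightarrow> R j" for P R x
      unfolding G_def using fin that by (intro sum_mono2) auto
    have G_pos: "\<exists>Q\<in>S. x \<in> Q \<and> P (lev Q)" if "lam powr p < G P x" for P x
    proof (rule ccontr)
      assume "\<not> (\<exists>Q\<in>S. x \<in> Q \<and> P (lev Q))"
      then have "{Q\<in>S. x \<in> Q \<and> P (lev Q)} = {}" by blast
      then have "G P x = 0" unfolding G_def by (simp only: sum.empty)
      with that show False using powr_ge_zero[of lam p] by simp
    qed
    \<comment> \<open>Only cubes of level at most \<open>i\<close> enter the definition of
      \<open>Om i\<close>, and each of them is a union of level \<open>i\<close> cells.\<close>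
    have Omsat: "Om i \<in> saturated i" for i
    proof -
      have Geq: "G P x = G P y" if eq: "fine_index i x = fine_index i y" and P: "\<And>j. P j \<Longrightarrow> j \<le> i" for P x y
      proof -
        have "x \<in> Q \<longleftrightarrow> y \<in> Q" if "Q \<in> S" "P (lev Q)" for Q
        proof -
          have "Q \<in> saturated (lev Q)" using lev[OF that(1)] dyadic_cube_saturated[OF \<alpha>] by metis
          moreover have "fine_index (lev Q) x = fine_index (lev Q) y"
            using fine_index_mono[OF P[OF that(2)] eq] .
          ultimately show ?thesis using saturated_iff by blast
        qed
        then show ?thesis unfolding G_def by (intro sum.cong) auto
      qed
      show ?thesis
        unfolding saturated_def mem_Collect_eq
      proof (intro ballI allI impI)
        fix x y assume x: "x \<in> Om i" and eq: "fine_index i x = fine_index i y"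
        show "y \<in> Om i"
          using x Geq[OF eq, of "\<lambda>j. j < i"] Geq[OF eq, of "\<lambda>j. j \<le> i"] by (simp add: Om_def)
      qed
    qed
    have Oms: "Om i \<in> sets lebesgue" for i by (rule sets_saturated[OF Omsat])
    have cover: "\<exists>i\<in>?J. x \<in> Om i" if "lam powr p < G (\<lambda>_. True) x" for x
    proof -
      let ?I = "{i\<in>?J. lam powr p < G (\<lambda>j. j \<le> i) x}"
      have ne: "?J \<noteq> {}" using G_pos[OF that] by auto
      have "G (\<lambda>_. True) x \<le> G (\<lambda>j. j \<le> Max ?J) x"
        unfolding G_def using fin by (intro sum_mono2) auto
      then have "Max ?J \<in> ?I" using that ne fin by auto
      then have I: "?I \<noteq> {}" "finite ?I" using fin by auto
      define i where "i = Min ?I"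
      have i: "i \<in> ?I" using I unfolding i_def by (rule Min_in[rotated])
      have "G (\<lambda>j. j < i) x \<le> lam powr p"
      proof (rule ccontr)
        assume n: "\<not> G (\<lambda>j. j < i) x \<le> lam powr p"
        \<comment> \<open>Below \<open>i\<close> the partial sum changes only at levels that occur
          in \<open>S\<close>. If it had already exceeded the threshold, the largest such level
          would contradict the minimality of \<open>i\<close>.\<close>
        let ?K = "{j\<in>?J. j < i}"
        have ne: "?K \<noteq> {}" using G_pos[of "\<lambda>j. j < i" x] n by auto
        have fK: "finite ?K" using fin by auto
        have "G (\<lambda>j. j < i) x \<le> G (\<lambda>j. j \<le> Max ?K) x"
          unfolding G_def using fin fK by (intro sum_mono2) auto
        moreover have "Max ?K \<in> ?K" using ne fK by (rule Max_in[rotated])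
        ultimately have "Max ?K \<in> ?I" "Max ?K < i" using n by auto
        then show False using I unfolding i_def by (meson Min_le linorder_not_less)
      qed
      then show ?thesis using i unfolding Om_def by auto
    qed
    \<comment> \<open>Once the sum has exceeded the threshold at level \<open>i\<close>, it exceeds
      it before every later level, so a second stopping is impossible.\<close>
    have disj: "disjoint_family_on Om ?J"
    proof -
      have "Om i \<inter> Om j = {}" if "i < j" for i j
      proof -
        have "G (\<lambda>k. k \<le> i) x \<le> G (\<lambda>k. k < j) x" for x using that by (intro G_mono) auto
        then show ?thesis unfolding Om_def by (force dest: order_trans)
      qed
      then show ?thesis unfolding disjoint_family_on_def by (metis Int_commute linorder_neqE)
    qed
    define N where "N = (\<lambda>i x. card {j\<in>?J. i \<le> j \<and> x \<in> \<Union>{Q\<in>S. lev Q = j}})"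
    \<comment> \<open>Before level \<open>i\<close> the sum is at most \<open>lam powr p\<close>, so
      the cubes of level \<open>i\<close> and finer carry more than \<open>D * lam powr p\<close>.
      Level \<open>i\<close> itself belongs to this tail, matching the condition
      \<open>i \<le> j\<close> in \<open>N\<close>.\<close>
    have hit: "c / \<gamma> \<le> real (N i x)" if xT: "x \<in> T" and x: "x \<in> Om i" for i x
    proof -
      let ?F = "{Q\<in>S. x \<in> Q \<and> i \<le> lev Q}"
      have "(2 * lam) powr p < G (\<lambda>_. True) x" using xT lam by (simp add: T_def op_less)
      also have "\<dots> = G (\<lambda>j. j < i) x + G (\<lambda>j. i \<le> j) x"
        using G_split[of "\<lambda>_. True" x "\<lambda>j. j < i"] by (simp add: not_less)
      also have "\<dots> \<le> lam powr p + G (\<lambda>j. i \<le> j) x" using x by (simp add: Om_def)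
      finally have "(2 * lam) powr p < lam powr p + G (\<lambda>j. i \<le> j) x" .
      moreover have "(2 * lam) powr p = D * lam powr p + lam powr p"
        using lam by (simp add: D_def powr_mult left_diff_distrib)
      ultimately have "D * lam powr p < G (\<lambda>j. i \<le> j) x" by linarith
      then have low: "D * lam powr p < (\<Sum>Q\<in>?F. a Q powr p)" unfolding G_def .
      have "sparse_op r S a x \<le> \<gamma> powr (1 / p - inv_exp r) * lam"
        using xT p by (simp add: T_def inv_exp_def)
      then have "c / \<gamma> \<le> real (card ?F)"
        by (intro count[OF fin a _ lam g _ low]) auto
      also have "card ?F = card (lev ` ?F)"
        using lev_inj by (intro card_image[symmetric] inj_onI) auto
      also have "real \<dots> \<le> real (N i x)"
        unfolding N_def of_nat_le_iff using fin by (intro card_mono) auto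
      finally show ?thesis .
    qed
    define K where "K = ennreal (2 * exp (- (c / \<gamma> * \<eta> / (4 * 14 ^ CARD('n) * W))))"
    \<comment> \<open>\<open>wmeas\<close> is monotone on arbitrary sets; measurability enters only
      for the union on the right, where subadditivity is applied.\<close>
    have "wmeas w T \<le> wmeas w (\<Union>i\<in>?J. {x\<in>Om i. c / \<gamma> \<le> real (N i x)})"
    proof (rule wmeas_mono, rule subsetI)
      fix x assume xT: "x \<in> T"
      have "lam powr p \<le> (2 * lam) powr p" using lam p by (intro powr_mono2) auto
      also have "\<dots> < G (\<lambda>_. True) x" using xT lam by (simp add: T_def op_less)
      finally obtain i where "i \<in> ?J" "x \<in> Om i" using cover by blast
      then show "x \<in> (\<Union>i\<in>?J. {x\<in>Om i. c / \<gamma> \<le> real (N i x)})" using hit[OF xT] by blast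
    qed
    also have "\<dots> \<le> (\<Sum>i\<in>?J. wmeas w {x\<in>Om i. c / \<gamma> \<le> real (N i x)})"
    proof -
      have "(\<lambda>x. real (N i x)) \<in> borel_measurable lebesgue" for i
        unfolding N_def by (rule borel_measurable_level_count[OF \<alpha> fin lev])
      then have "{x\<in>space lebesgue. c / \<gamma> \<le> real (N i x)} \<in> sets lebesgue" for i
        by measurable
      then have *: "Om i \<inter> {x. c / \<gamma> \<le> real (N i x)} \<in> sets lebesgue" for i
        using Oms by auto
      have "{x\<in>Om i. c / \<gamma> \<le> real (N i x)} = Om i \<inter> {x. c / \<gamma> \<le> real (N i x)}" for i
        by auto
      with * have sets: "{x\<in>Om i. c / \<gamma> \<le> real (N i x)} \<in> sets lebesgue" for i
        by metis
      have "emeasure M (\<Union>i\<in>?J. {x\<in>Om i. c / \<gamma> \<le> real (N i x)})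
          \<le> (\<Sum>i\<in>?J. emeasure M {x\<in>Om i. c / \<gamma> \<le> real (N i x)})"
        using fin sets by (intro emeasure_subadditive_finite) (auto simp: M_def)
      then show ?thesis
        using fin sets by (subst (asm) M) (auto simp: M)
    qed
    also have "\<dots> \<le> (\<Sum>i\<in>?J. K * wmeas w (Om i))"
      unfolding K_def N_def using c g
      by (intro sum_mono counting_tail[OF w FW W1 \<alpha> fin eta sp lev Omsat]) auto
    also have "\<dots> = K * (\<Sum>i\<in>?J. emeasure M (Om i))"
      using Oms by (simp add: sum_distrib_left M)
    also have "(\<Sum>i\<in>?J. emeasure M (Om i)) = emeasure M (\<Union>i\<in>?J. Om i)"
      using fin Oms disj by (intro sum_emeasure) (auto simp: M_def)
    also have "\<dots> = wmeas w (\<Union>i\<in>?J. Om i)"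
      using fin Oms by (intro M) auto
    \<comment> \<open>The stopping sets are disjoint and lie in the set where the full sum exceeds
      \<open>lam powr p\<close>, so their weights add up without loss.\<close>
    also have "K * \<dots> \<le> K * wmeas w {x. lam < sparse_op q S a x}"
    proof (intro mult_left_mono wmeas_mono subsetI)
      fix x assume "x \<in> (\<Union>i\<in>?J. Om i)"
      then obtain i where "lam powr p < G (\<lambda>j. j \<le> i) x" by (auto simp: Om_def)
      also have "\<dots> \<le> G (\<lambda>_. True) x" by (rule G_mono) simp
      finally show "x \<in> {x. lam < sparse_op q S a x}" using lam by (simp add: op_less)
    qed simp
    also have "K = ennreal (2 * exp (- (c / (4 * 14 ^ CARD('n))) * \<eta> / (\<gamma> * enn2real (FW_const w))))"
      unfolding K_def W_def by (simp add: ac_simps)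
    finally show "wmeas w {x. 2 * lam < sparse_op q S a x \<and>
                       sparse_op r S a x \<le> \<gamma> powr (inv_exp q - inv_exp r) * lam}
      \<le> ennreal (2 * exp (- (c / (4 * 14 ^ CARD('n))) * \<eta> / (\<gamma> * enn2real (FW_const w))))
         * wmeas w {x. lam < sparse_op q S a x}"
      unfolding T_def .
  qed (use c in auto)
qed

end
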